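(* Assume the following. (1) The weight $w$ is bounded and Lipschitz. (2) $K_Z:\mathbb R^d\to[0,\infty)$ and $K_U:\mathbb R^2\to[0,\infty)$ are bounded, Lipschitz, integrate to one, are supported in the closed unit balls of $\mathbb R^d$ and $\mathbb R^2$ respectively, and there are $\rho_{K,Z},\rho_{K,U},k_Z,k_U>0$ with $K_Z(x)\ge k_Z$ whenever $\|x\|\le\rho_{K,Z}$ and $K_U(y)\ge k_U$ whenever $\|y\|\le\rho_{K,U}$. The positive bandwidths $h_Z=h_{Z,n}$, $h_U=h_{U,n}$ satisfy $h_Z\to0$, $h_U\to0$ and $nh_Z^dh_U^2/\log n\to\infty$. (3) $\mathcal Z\subset\mathbb R^d$ is compact and there are $\rho_Z,\eta_Z>0$ such that for every $z\in\mathcal Z$ there is a unit vector $\xi_z$ with $\{z+tv:0<t<\rho_Z,\ \|v\|=1,\ \|v-\xi_z\|<\eta_Z\}\subset\mathcal Z$. (4) The law of $Z$ has a density $p_Z$ on $\mathcal Z$ with $0<c_Z\le p_Z(z)\le C_Z<\infty$ for all $z\in\mathcal Z$. (5) $\Lambda_z^w$ is absolutely continuous with respect to Lebesgue measure on $\overline\Omega_L$, with density $\lambda_w:\mathcal Z\times\overline\Omega_L\to[0,\infty)$ that is bounded and uniformly continuous. (No almost-sure bound on $\mu_D^w(\overline\Omega_L)$ is assumed.) Let $M(D)=\mu_D^w(\overline\Omega_L)$, let $M_n\uparrow\infty$ be deterministic, and let $\lambda_{w,n}^{\mathrm{tr}}(z,\cdot)$ be the density of $A\mapsto\mathbb E[\mu_D^w(A)\mathbf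 1\{M(D)\le M_n\}\mid Z=z]$. Suppose, for a constant $C_Y$ independent of $n$, that $$n\,\mathbb P\{M(D)>M_n\}\to0,\qquad\frac{M_n\log n}{nh_Z^dh_U^2}\to0,\qquad\|\lambda_{w,n}^{\mathrm{tr}}-\lambda_w\|_\infty\to0,$$ and $$\sup_{z\in\mathcal Z,u\in\overline\Omega_L}\mathbb E\bigl[(Y^w_{h_U}(u))^2\mid Z=z\bigr]\le C_Yh_U^{-2}.$$ Then $\|\widehat\lambda_{w,n}-\lambda_w\|_\infty\to0$ in probability.
   Context: Fix $L>0$ and let $\Omega_L=\{(b,t):0\le b<t\le L\}$, $\overline\Omega_L=\{(b,t):0\le b\le t\le L\}$, $\Delta_L=\{(b,b):0\le b\le L\}$. $\|\cdot\|$ is the Euclidean norm and $\|g\|_\infty=\sup_{z\in\mathcal Z,u\in\overline\Omega_L}|g(z,u)|$. A persistence diagram $D$ supported in $\Omega_L$ is identified with a locally finite counting measure $\mu_D=\sum_{x\in D}a_x\delta_x$, $a_x\in\mathbb N$. A weight is a measurable $w:\overline\Omega_L\to[0,\infty)$ with $w=0$ on $\Delta_L$; $\mu_D^w(A)=\int_Aw\,d\mu_D$ for Borel $A\subseteq\overline\Omega_L$. $(Z_i,D_i)$, $i=1,\dots,n$, are i.i.d. copies of $(Z,D)$, with $Z\in\mathcal Z\subset\mathbb R^d$ and $D$ a random persistence diagram. Put $\mu_i^w=\mu_{D_i}^w$ and $\Lambda_z^w(A)=\mathbb E[\mu_i^w(A)\mid Z_i=z]$. For $h>0$ define $c_{Z,h}(z)=\int_{\mathcal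 Z}h^{-d}K_Z((z'-z)/h)\,dz'$, $c_{U,h}(u)=\int_{\overline\Omega_L}h^{-2}K_U((v-u)/h)\,dv$, $\kappa_{Z,h}(z,z')=h^{-d}K_Z((z'-z)/h)/c_{Z,h}(z)$, $\kappa_{U,h}(u,v)=h^{-2}K_U((v-u)/h)/c_{U,h}(u)$. Set $Y^w_{h_U}(u)=\int_{\overline\Omega_L}\kappa_{U,h_U}(u,v)\,d\mu_D^w(v)$, $Y^w_{i,h_U}(u)$ the same with $D_i$ in place of $D$, and $$\widehat\lambda_{w,n}(z,u)=\frac{\sum_{i=1}^n\kappa_{Z,h_Z}(z,Z_i)Y^w_{i,h_U}(u)}{\sum_{i=1}^n\kappa_{Z,h_Z}(z,Z_i)},$$ with value zero when the denominator is zero. *)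

theory Defs
  imports "HOL-Probability.Probability"
begin

definition Omega :: "real \<Rightarrow> (real \<times> real) set" where
  "Omega L = {(b, t). 0 \<le> b \<and> b < t \<and> t \<le> L}"

definition Omega_bar :: "real \<Rightarrow> (real \<times> real) set" where
  "Omega_bar L = {(b, t). 0 \<le> b \<and> b \<le> t \<and> t \<le> L}"

definition Diagonal :: "real \<Rightarrow> (real \<times> real) set" where
  "Diagonal L = {(b, t). b = t \<and> 0 \<le> b \<and> b \<le> L}"

abbreviation borel_bar :: "real \<Rightarrow> (real \<times> real) measure" where
  "borel_bar L \<equiv> restrict_space borel (Omega_bar L)"

abbreviation lebesgue_bar :: "real \<Rightarrow> (real \<times> real) measure" where
  "lebesgue_bar L \<equiv> restrict_space lborel (Omega_bar L)"

text \<open>A diagram is given by its multiplicity function. Local finiteness means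
  finiteness on compact subsets of \<^term>\<open>Omega L\<close>, so infinitely many points may accumulate at
  the diagonal.\<close>

definition diagrams :: "real \<Rightarrow> (real \<times> real \<Rightarrow> nat) set" where
  "diagrams L = {a. (\<forall>x. a x \<noteq> 0 \<longrightarrow> x \<in> Omega L) \<and>
     (\<forall>C. compact C \<and> C \<subseteq> Omega L \<longrightarrow> finite {x \<in> C. a x \<noteq> 0})}"

definition diagram_measure :: "real \<Rightarrow> (real \<times> real \<Rightarrow> nat) \<Rightarrow> (real \<times> real) measure" where
  "diagram_measure L a =
     distr (density (count_space (Omega_bar L)) (\<lambda>x. of_nat (a x))) (borel_bar L) (\<lambda>x. x)"

lemma emeasure_diagram_measure:
  assumes "A \<in> sets (borel_bar L)"
  shows "emeasure (diagram_measure L a) A = (\<integral>\<^sup>+x. of_nat (a x) \<partial>count_space A)"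
proof -
  have sub: "A \<subseteq> Omega_bar L"
    using sets.sets_into_space[OF assms] by (simp add: space_restrict_space)
  have id: "(\<lambda>x. x) \<in> density (count_space (Omega_bar L)) (\<lambda>x. of_nat (a x)) \<rightarrow>\<^sub>M borel_bar L"
    by (auto simp: measurable_def space_restrict_space)
  have "emeasure (diagram_measure L a) A =
      emeasure (density (count_space (Omega_bar L)) (\<lambda>x. of_nat (a x))) A"
    unfolding diagram_measure_def
    using sub by (subst emeasure_distr[OF id assms]) (simp add: Int_absorb2)
  also have "\<dots> = (\<integral>\<^sup>+x. of_nat (a x) * indicator A x \<partial>count_space (Omega_bar L))"
    using sub by (subst emeasure_density) auto
  also have "\<dots> = (\<integral>\<^sup>+x. of_nat (a x) * indicator A x \<partial>count_space UNIV)"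
    using sub by (subst nn_integral_count_space_indicator[of "Omega_bar L"])
      (auto intro!: nn_integral_cong simp: indicator_def)
  also have "\<dots> = (\<integral>\<^sup>+x. of_nat (a x) \<partial>count_space A)"
    by (simp add: nn_integral_count_space_indicator)
  finally show ?thesis .
qed

text \<open>The space of diagrams carries the \<open>\<sigma>\<close>-algebra generated by all evaluations on Borel sets.\<close>

definition diagram_space :: "real \<Rightarrow> (real \<times> real \<Rightarrow> nat) measure" where
  "diagram_space L = sigma (diagrams L)
     {{a \<in> diagrams L. emeasure (diagram_measure L a) A \<in> B} | A B.
        A \<in> sets (borel_bar L) \<and> B \<in> sets borel}"

definition weight :: "real \<Rightarrow> (real \<times> real \<Rightarrow> real) \<Rightarrow> bool" where
  "weight L w \<longleftrightarrow> w \<in> borel_measurable (borel_bar L) \<and>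
     (\<forall>u\<in>Omega_bar L. 0 \<le> w u) \<and> (\<forall>u\<in>Diagonal L. w u = 0)"

definition weighted_measure ::
  "real \<Rightarrow> (real \<times> real \<Rightarrow> real) \<Rightarrow> (real \<times> real \<Rightarrow> nat) \<Rightarrow> (real \<times> real) measure" where
  "weighted_measure L w a = density (diagram_measure L a) (\<lambda>v. ennreal (w v))"

definition total_mass ::
  "real \<Rightarrow> (real \<times> real \<Rightarrow> real) \<Rightarrow> (real \<times> real \<Rightarrow> nat) \<Rightarrow> ennreal" where
  "total_mass L w a = emeasure (weighted_measure L w a) (Omega_bar L)"

text \<open>\<^term>\<open>g\<close> is a version of \<open>z \<mapsto> E[X | Z = z]\<close>, for a random variable \<^term>\<open>Z\<close> with values in
  \<^term>\<open>N\<close>.\<close>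

definition cond_exp_version ::
  "'w measure \<Rightarrow> 'z measure \<Rightarrow> ('w \<Rightarrow> 'z) \<Rightarrow> ('w \<Rightarrow> ennreal) \<Rightarrow> ('z \<Rightarrow> ennreal) \<Rightarrow> bool" where
  "cond_exp_version P N Z X g \<longleftrightarrow>
     X \<in> borel_measurable P \<and> g \<in> borel_measurable N \<and>
     (AE \<omega> in P. nn_cond_exp P (vimage_algebra (space P) Z N) X \<omega> = g (Z \<omega>))"

definition iid_copies ::
  "'w measure \<Rightarrow> 'x measure \<Rightarrow> (nat \<Rightarrow> 'w \<Rightarrow> 'x) \<Rightarrow> ('w \<Rightarrow> 'x) \<Rightarrow> bool" where
  "iid_copies P N Xs X \<longleftrightarrow>
     prob_space.indep_vars P (\<lambda>_. N) Xs {1..} \<and> (\<forall>i\<ge>1. distr P N (Xs i) = distr P N X)"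

definition admissible_kernel :: "('a::euclidean_space \<Rightarrow> real) \<Rightarrow> bool" where
  "admissible_kernel K \<longleftrightarrow>
     (\<forall>x. 0 \<le> K x) \<and> bounded (range K) \<and> (\<exists>C. C-lipschitz_on UNIV K) \<and>
     has_bochner_integral lborel K 1 \<and> (\<forall>x. K x \<noteq> 0 \<longrightarrow> norm x \<le> 1) \<and>
     (\<exists>\<rho>>0. \<exists>k>0. \<forall>x. norm x \<le> \<rho> \<longrightarrow> k \<le> K x)"

definition scaled_kernel :: "('a::euclidean_space \<Rightarrow> real) \<Rightarrow> real \<Rightarrow> 'a \<Rightarrow> 'a \<Rightarrow> real" where
  "scaled_kernel K h x y = K ((y - x) /\<^sub>R h) / h ^ DIM('a)"

definition kernel_mass :: "('a::euclidean_space) set \<Rightarrow> ('a \<Rightarrow> real) \<Rightarrow> real \<Rightarrow> 'a \<Rightarrow> real" where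
  "kernel_mass S K h x = (LINT y:S|lborel. scaled_kernel K h x y)"

definition kappa :: "('a::euclidean_space) set \<Rightarrow> ('a \<Rightarrow> real) \<Rightarrow> real \<Rightarrow> 'a \<Rightarrow> 'a \<Rightarrow> real" where
  "kappa S K h x y = scaled_kernel K h x y / kernel_mass S K h x"

text \<open>The Bochner integral is the usual one whenever it is finite; it takes the value 0 for a
  diagram with infinite smoothed mass at \<^term>\<open>u\<close>, which requires infinite total mass.\<close>

definition smoothed ::
  "real \<Rightarrow> (real \<times> real \<Rightarrow> real) \<Rightarrow> (real \<times> real \<Rightarrow> real) \<Rightarrow> real \<Rightarrow>
   (real \<times> real \<Rightarrow> nat) \<Rightarrow> real \<times> real \<Rightarrow> real" where
  "smoothed L w KU h a u = (LINT v|weighted_measure L w a. kappa (Omega_bar L) KU h u v)"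

text \<open>A vanishing denominator yields 0 because \<open>x / 0 = 0\<close>.\<close>

definition lambda_hat ::
  "real \<Rightarrow> (real \<times> real \<Rightarrow> real) \<Rightarrow> ('a::euclidean_space) set \<Rightarrow> ('a \<Rightarrow> real) \<Rightarrow>
   (real \<times> real \<Rightarrow> real) \<Rightarrow> real \<Rightarrow> real \<Rightarrow> nat \<Rightarrow> (nat \<Rightarrow> 'a) \<Rightarrow>
   (nat \<Rightarrow> real \<times> real \<Rightarrow> nat) \<Rightarrow> 'a \<Rightarrow> real \<times> real \<Rightarrow> real" where
  "lambda_hat L w S KZ KU hZ hU n zs as z u =
     (\<Sum>i=1..n. kappa S KZ hZ z (zs i) * smoothed L w KU hU (as i) u) /
     (\<Sum>i=1..n. kappa S KZ hZ z (zs i))"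

definition cone_condition :: "('a::euclidean_space) set \<Rightarrow> bool" where
  "cone_condition S \<longleftrightarrow> (\<exists>\<rho>>0. \<exists>\<eta>>0. \<forall>z\<in>S. \<exists>\<xi>. norm \<xi> = 1 \<and>
     {z + t *\<^sub>R v | t v. 0 < t \<and> t < \<rho> \<and> norm v = 1 \<and> norm (v - \<xi>) < \<eta>} \<subseteq> S)"

definition sup_norm :: "real \<Rightarrow> 'a set \<Rightarrow> ('a \<Rightarrow> real \<times> real \<Rightarrow> real) \<Rightarrow> ennreal" where
  "sup_norm L S g = (SUP z\<in>S. SUP u\<in>Omega_bar L. ennreal \<bar>g z u\<bar>)"

text \<open>Outer probability is used because an uncountable supremum need not be measurable; on events
  it agrees with the probability.\<close>

definition tendsto_zero_in_prob :: "'w measure \<Rightarrow> (nat \<Rightarrow> 'w \<Rightarrow> ennreal) \<Rightarrow> bool" where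
  "tendsto_zero_in_prob P X \<longleftrightarrow>
     (\<forall>\<epsilon>>0. (\<lambda>n. outer_measure_of P {\<omega> \<in> space P. ennreal \<epsilon> < X n \<omega>}) \<longlonglongrightarrow> 0)"

end

theory Submission
  imports Defs
begin

text \<open>
  The estimator is a ratio of two averages. Replace every diagram of total mass above \<open>M\<^sub>n\<close> by the
  empty one. By the tail assumption and a union bound over the sample, this changes the estimator
  only on an event of vanishing probability, and it makes the summands of the numerator bounded by
  a multiple of \<open>M\<^sub>n / (h\<^sub>Z\<^sup>d h\<^sub>U\<^sup>2)\<close>. Let \<open>N\<close> be the average in the numerator after truncation and
  \<open>F\<close> the average in the denominator.

  Bias. The kernels are normalised on the domain, so they are probability densities in their
  second argument, also at the boundary. Conditioning on \<open>Z\<close> shows that the mean of \<open>N(z, u)\<close>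
  differs from \<open>\<lambda>(z, u)\<close> times the mean of \<open>F(z)\<close> by at most a small multiple of the latter:
  the truncated intensity is uniformly close to \<open>\<lambda>\<close>, and \<open>\<lambda>\<close> is uniformly continuous. The mean of
  \<open>F\<close> lies between the bounds of the density of \<open>Z\<close>, in particular away from zero
  (\<open>numerator_mean_bounds\<close>, \<open>expectation_kappa_bounds\<close>).

  Fluctuation. The second moments of the summands of \<open>N\<close> are at most of order \<open>1 / (h\<^sub>Z\<^sup>d h\<^sub>U\<^sup>2)\<close>, with no
  factor \<open>M\<^sub>n\<close> (\<open>second_moment_bound\<close>). In a Bernstein inequality the bandwidth condition handles
  the second moment and the rate condition on \<open>M\<^sub>n\<close> handles the range; the probability of
  a deviation at one point \<open>(z, u)\<close> then decays faster than any power of \<open>n\<close>. All Lipschitz constants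
  are polynomial in \<open>n\<close>, so a net of polynomial size reduces the supremum to a union bound
  (\<open>uniform_concentration\<close>, applied once to \<open>N\<close> and once to \<open>F\<close>).

  The constants for the kernels need a lower bound for the mass that a kernel centred at a point of
  the domain leaves inside the domain. It follows from the cone condition on the design set and
  from convexity of the triangle (\<open>kernel_mass_ge_if_fat\<close>). Finally, \<open>N / F - \<lambda>\<close> is small because
  \<open>N - \<lambda> F\<close> is small and \<open>F\<close> is bounded below (\<open>ratio_deviation_le\<close>).
\<close>

section \<open>Sets that fill a fixed fraction of small balls\<close>

text \<open>The scale-invariant form of the cone condition that the normalisation of a kernel needs: near
every point of the set, boundary points included, the set fills a fixed fraction of each small ball.\<close>

definition fat :: "'a::euclidean_space set \<Rightarrow> bool" where
  "fat S \<longleftrightarrow> (\<exists>\<delta>>0. \<exists>r0>0. \<forall>x\<in>S. \<forall>r. 0 < r \<and> r \<le> r0 \<longrightarrow>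
     (\<exists>y. ball y (\<delta> * r) \<subseteq> S \<inter> cball x r))"

text \<open>The segment of length \<open>r\<close> in the axial direction \<open>\<xi>\<close> has its midpoint \<open>x + (r/2) \<xi>\<close>
well inside the cone: moving it by less than \<open>\<delta> r\<close> changes its direction, seen from \<open>x\<close>,
by less than \<open>4 \<delta>\<close>, which is at most the opening \<open>\<eta>\<close>.\<close>

lemma fat_if_cone_condition:
  fixes S :: "'a::euclidean_space set"
  assumes "cone_condition S"
  shows "fat S"
proof -
  obtain \<rho> \<eta> where \<rho>: "\<rho> > 0" and \<eta>: "\<eta> > 0" and cone:
    "\<And>z. z \<in> S \<Longrightarrow> \<exists>\<xi>. norm \<xi> = 1 \<and>
       {z + t *\<^sub>R v | t v. 0 < t \<and> t < \<rho> \<and> norm v = 1 \<and> norm (v - \<xi>) < \<eta>} \<subseteq> S"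
    using assms unfolding cone_condition_def by blast
  define \<delta> where "\<delta> = min (1/4) (\<eta> / 8)"
  have \<delta>: "\<delta> > 0" "\<delta> \<le> 1/4" "4 * \<delta> < \<eta>"
    using \<eta> by (auto simp: \<delta>_def)
  have "\<exists>y. ball y (\<delta> * r) \<subseteq> S \<inter> cball x r" if x: "x \<in> S" and r: "0 < r" "r \<le> \<rho>" for x r
  proof -
    obtain \<xi> where \<xi>: "norm \<xi> = 1" and sub:
      "{x + t *\<^sub>R v | t v. 0 < t \<and> t < \<rho> \<and> norm v = 1 \<and> norm (v - \<xi>) < \<eta>} \<subseteq> S"
      using cone[OF x] by blast
    have "a \<in> S \<inter> cball x r" if a: "a \<in> ball (x + (r/2) *\<^sub>R \<xi>) (\<delta> * r)" for a
    proof -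
      define y where "y = a - x"
      define t where "t = norm y"
      have d: "norm (y - (r/2) *\<^sub>R \<xi>) < \<delta> * r"
        using a by (simp add: y_def dist_norm norm_minus_commute algebra_simps)
      have "\<bar>t - r/2\<bar> \<le> norm (y - (r/2) *\<^sub>R \<xi>)"
        using norm_triangle_ineq3[of y "(r/2) *\<^sub>R \<xi>"] r \<xi> by (simp add: t_def)
      hence tr: "\<bar>t - r/2\<bar> < \<delta> * r" using d by linarith
      have "\<delta> * r \<le> r / 4" using \<delta> r by simp
      hence t: "0 < t" "t < r" using tr by linarith+
      define v where "v = y /\<^sub>R t"
      have nv: "norm v = 1" using t by (simp add: v_def t_def)
      have "norm (v - \<xi>) * (r/2) = norm ((r/2) *\<^sub>R v - (r/2) *\<^sub>R \<xi>)"
        using r by (simp flip: scaleR_diff_right)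
      also have "\<dots> = norm ((r/2 - t) *\<^sub>R v + (y - (r/2) *\<^sub>R \<xi>))"
        using t by (simp add: v_def algebra_simps)
      also have "\<dots> \<le> norm ((r/2 - t) *\<^sub>R v) + norm (y - (r/2) *\<^sub>R \<xi>)"
        by (rule norm_triangle_ineq)
      also have "\<dots> < \<delta> * r + \<delta> * r"
        using d tr nv by (simp add: abs_minus_commute)
      finally have "norm (v - \<xi>) < 4 * \<delta>" using r by (simp add: field_simps)
      hence "norm (v - \<xi>) < \<eta>" using \<delta> by linarith
      moreover have "a = x + t *\<^sub>R v" using t by (simp add: v_def y_def)
      moreover have "t < \<rho>" using t r by linarith
      ultimately have "a \<in> S" using sub t nv by blast
      moreover have "dist x a \<le> r" using t by (simp add: t_def y_def dist_norm norm_minus_commute)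
      ultimately show ?thesis by simp
    qed
    thus ?thesis by blast
  qed
  thus ?thesis unfolding fat_def using \<delta>(1) \<rho> by blast
qed

text \<open>Shrinking a ball inside a convex set towards a point of the set keeps it inside the set; the
radius of the image and its distance from the point scale by the same factor.\<close>

lemma fat_if_convex:
  fixes S :: "'a::euclidean_space set"
  assumes "convex S" "bounded S" "interior S \<noteq> {}"
  shows "fat S"
proof -
  obtain c where "c \<in> interior S" using assms by blast
  then obtain e where e: "e > 0" "ball c e \<subseteq> S" by (auto simp: mem_interior)
  obtain R where R: "R > 0" "\<And>x. x \<in> S \<Longrightarrow> norm x \<le> R"
    using assms(2) bounded_pos by blast
  have c: "c \<in> S" using e by auto
  define \<delta> where "\<delta> = e / (2*R + e)"
  have \<delta>: "\<delta> > 0" using e R by (simp add: \<delta>_def)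
  have "\<exists>y. ball y (\<delta> * r) \<subseteq> S \<inter> cball x r" if x: "x \<in> S" and r: "0 < r" "r \<le> 2*R+e" for x r
  proof -
    \<comment> \<open>contraction factor: every point of the ball lies within \<open>2 R + e\<close> of \<open>x\<close>\<close>
    define s where "s = r / (2*R+e)"
    have s: "0 < s" "s \<le> 1" using r R e by (auto simp: s_def)
    have sr: "s * (2*R+e) = r" and se: "s * e = \<delta> * r" using R e by (auto simp: s_def \<delta>_def)
    have "a \<in> S \<inter> cball x r" if a: "a \<in> ball ((1-s) *\<^sub>R x + s *\<^sub>R c) (\<delta> * r)" for a
    proof -
      define y where "y = (a - (1-s) *\<^sub>R x) /\<^sub>R s"
      have ay: "a = (1-s) *\<^sub>R x + s *\<^sub>R y" using s by (simp add: y_def)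
      have "norm (s *\<^sub>R (y - c)) < s * e"
        using a unfolding se by (simp add: ay dist_norm norm_minus_commute algebra_simps)
      hence yc: "norm (y - c) < e" using s by simp
      hence "y \<in> S" using e by (auto simp: dist_norm norm_minus_commute)
      hence "a \<in> S" using convexD[OF assms(1) x] s ay by auto
      moreover have "dist x a = s * norm (y - x)"
        using s by (simp add: ay dist_norm norm_minus_commute algebra_simps flip: scaleR_diff_right)
      moreover have "norm (y - x) \<le> 2*R + e"
        using norm_triangle_ineq[of "y - c" "c - x"] norm_triangle_ineq4[of c x] yc R(2)[OF x] R(2)[OF c] by simp
      ultimately show ?thesis using sr s by (auto intro!: mult_left_mono simp flip: sr)
    qed
    thus ?thesis by blast
  qed
  moreover have "0 < 2*R+e" using R e by linarith
  ultimately show ?thesis unfolding fat_def using \<delta>(1) by blast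
qed

lemma compact_Omega_bar: "compact (Omega_bar L)"
proof -
  have eq: "Omega_bar L = {x. 0 \<le> fst x} \<inter> {x. fst x \<le> snd x} \<inter> {x. snd x \<le> L}"
    by (auto simp: Omega_bar_def)
  have "closed (Omega_bar L)"
    unfolding eq by (intro closed_Int closed_Collect_le continuous_intros)
  moreover have "Omega_bar L \<subseteq> cbox (0,0) (L,L)"
    by (auto simp: Omega_bar_def)
  ultimately show ?thesis
    by (meson bounded_cbox bounded_subset compact_eq_bounded_closed)
qed

lemma fat_Omega_bar:
  assumes "0 < L"
  shows "fat (Omega_bar L)"
proof (rule fat_if_convex)
  have eq: "Omega_bar L = {x. 0 \<le> fst x} \<inter> {x. fst x \<le> snd x} \<inter> {x. snd x \<le> L}"
    by (auto simp: Omega_bar_def)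
  show "convex (Omega_bar L)"
    unfolding convex_def Omega_bar_def
  proof (clarsimp, intro conjI)
    fix a b a' b' s t :: real
    assume *: "0 \<le> a" "a \<le> b" "b \<le> L" "0 \<le> a'" "a' \<le> b'" "b' \<le> L" "0 \<le> s" "0 \<le> t" "s + t = 1"
    have "s * b + t * b' \<le> s * L + t * L" using * by (intro add_mono mult_left_mono) auto
    also have "\<dots> = L" using * by (simp flip: distrib_right)
    finally show "s * b + t * b' \<le> L" .
    show "s * a + t * a' \<le> s * b + t * b'" using * by (intro add_mono mult_left_mono) auto
  qed
  show "bounded (Omega_bar L)" using compact_Omega_bar compact_imp_bounded by blast
  have "open ({x. 0 < fst x} \<inter> {x. fst x < snd x} \<inter> {x::real\<times>real. snd x < L})"
    by (intro open_Int open_Collect_less continuous_intros)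
  hence "({x. 0 < fst x} \<inter> {x. fst x < snd x} \<inter> {x::real\<times>real. snd x < L}) \<subseteq> interior (Omega_bar L)"
    unfolding eq by (intro interior_maximal) auto
  moreover have "(L/3, L/2) \<in> ({x. 0 < fst x} \<inter> {x. fst x < snd x} \<inter> {x::real\<times>real. snd x < L})"
    using assms by simp
  ultimately show "interior (Omega_bar L) \<noteq> {}" by blast
qed

section \<open>Normalised kernels\<close>

lemma continuous_on_if_admissible_kernel:
  assumes "admissible_kernel K"
  shows "continuous_on UNIV K"
  using assms lipschitz_on_continuous_on unfolding admissible_kernel_def by blast

lemma borel_measurable_admissible_kernel:
  assumes "admissible_kernel K"
  shows "K \<in> borel_measurable borel"
  using continuous_on_if_admissible_kernel[OF assms] by (rule borel_measurable_continuous_onI)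

lemma scaled_kernel_measurable:
  assumes "admissible_kernel K"
  shows "scaled_kernel K h x \<in> borel_measurable borel"
proof -
  note borel_measurable_admissible_kernel[OF assms, measurable]
  show ?thesis unfolding scaled_kernel_def[abs_def] by measurable
qed

lemma scaled_kernel_nonneg:
  assumes "admissible_kernel K" "0 < h"
  shows "0 \<le> scaled_kernel K h x y"
  using assms by (auto simp: scaled_kernel_def admissible_kernel_def)

lemma kernel_mass_nonneg:
  assumes "admissible_kernel K" "0 < h"
  shows "0 \<le> kernel_mass S K h x"
  unfolding kernel_mass_def set_lebesgue_integral_def
  by (intro integral_nonneg_AE) (simp add: scaled_kernel_nonneg[OF assms])

lemma kappa_nonneg:
  assumes "admissible_kernel K" "0 < h"
  shows "0 \<le> kappa S K h x y"
  unfolding kappa_def using scaled_kernel_nonneg[OF assms] kernel_mass_nonneg[OF assms]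
  by (intro divide_nonneg_nonneg)

lemma kappa_measurable:
  assumes "admissible_kernel K"
  shows "kappa S K h x \<in> borel_measurable borel"
proof -
  note scaled_kernel_measurable[OF assms, measurable]
  show ?thesis unfolding kappa_def[abs_def] by measurable
qed

lemma kappa_eq_0_if_dist_gt:
  assumes "admissible_kernel K" "0 < h" "h < dist x y"
  shows "kappa S K h x y = 0"
proof -
  have "norm ((y - x) /\<^sub>R h) = dist x y / h"
    using assms(2) by (simp add: dist_norm norm_minus_commute divide_inverse mult.commute)
  hence "\<not> norm ((y - x) /\<^sub>R h) \<le> 1"
    using assms(2,3) by simp
  thus ?thesis using assms(1) by (auto simp: kappa_def scaled_kernel_def admissible_kernel_def)
qed

lemma scaled_kernel_set_integrable:
  fixes S :: "'a::euclidean_space set"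
  assumes "admissible_kernel K" "compact S"
  shows "set_integrable lborel S (scaled_kernel K h x)"
  unfolding set_integrable_def
proof (rule borel_integrable_compact[OF assms(2)])
  have "continuous_on S (\<lambda>y. K ((y - x) /\<^sub>R h))"
    by (rule continuous_on_compose2[OF continuous_on_if_admissible_kernel[OF assms(1)]])
       (auto intro!: continuous_intros)
  thus "continuous_on S (scaled_kernel K h x)"
    unfolding scaled_kernel_def[abs_def] divide_inverse by (intro continuous_intros)
qed

text \<open>Dividing by the mass inside \<open>S\<close> makes \<^const>\<open>kappa\<close> a probability density on \<open>S\<close> exactly,
with no boundary correction. Both means in the bias estimate are averages because of this.\<close>

lemma nn_integral_kappa:
  fixes S :: "'a::euclidean_space set"
  assumes "admissible_kernel K" "compact S" "0 < h" "0 < kernel_mass S K h x"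
  shows "(\<integral>\<^sup>+y. ennreal (kappa S K h x y) \<partial>restrict_space lborel S) = 1"
proof -
  have S: "S \<in> sets lborel" using assms(2) by (simp add: borel_compact)
  have "(\<integral>\<^sup>+y. ennreal (kappa S K h x y) \<partial>restrict_space lborel S) =
      (\<integral>\<^sup>+y. ennreal (kappa S K h x y) * indicator S y \<partial>lborel)"
    using S by (subst nn_integral_restrict_space) auto
  also have "\<dots> = (\<integral>\<^sup>+y. ennreal (indicator S y *\<^sub>R kappa S K h x y) \<partial>lborel)"
    by (intro nn_integral_cong) (auto simp: indicator_def)
  also have "\<dots> = ennreal (\<integral>y. indicator S y *\<^sub>R kappa S K h x y \<partial>lborel)"
  proof (rule nn_integral_eq_integral)
    show "integrable lborel (\<lambda>y. indicator S y *\<^sub>R kappa S K h x y)"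
      using scaled_kernel_set_integrable[OF assms(1,2), of h x]
      unfolding set_integrable_def kappa_def by (simp add: field_simps)
  qed (simp add: kappa_nonneg[OF assms(1,3)])
  also have "(\<integral>y. indicator S y *\<^sub>R kappa S K h x y \<partial>lborel) = kernel_mass S K h x / kernel_mass S K h x"
    unfolding kappa_def kernel_mass_def set_lebesgue_integral_def by simp
  finally show ?thesis using assms(4) by simp
qed

text \<open>The kernel is at least \<open>k\<close> on the ball of radius \<open>\<rho> h\<close> about \<open>x\<close>, and a fat set contains a ball
of radius \<open>\<delta> \<rho> h\<close> in there. Its volume is proportional to \<open>h\<close> to the power of the dimension,
which cancels the normalising factor of the scaled kernel.\<close>

lemma kernel_mass_ge_if_fat:
  fixes S :: "'a::euclidean_space set"
  assumes K: "admissible_kernel K" and S: "compact S" "fat S"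
  obtains c h0 where "0 < c" "0 < h0"
    "\<And>h x. \<lbrakk>0 < h; h \<le> h0; x \<in> S\<rbrakk> \<Longrightarrow> c \<le> kernel_mass S K h x"
proof -
  obtain \<delta> r0 where \<delta>: "\<delta> > 0" and r0: "r0 > 0" and fat:
    "\<And>x r. \<lbrakk>x \<in> S; 0 < r; r \<le> r0\<rbrakk> \<Longrightarrow> \<exists>y. ball y (\<delta> * r) \<subseteq> S \<inter> cball x r"
    using S(2) unfolding fat_def by blast
  obtain \<rho> k where \<rho>: "\<rho> > 0" and k: "k > 0" "\<And>x. norm x \<le> \<rho> \<Longrightarrow> k \<le> K x"
    using K unfolding admissible_kernel_def by blast
  define c where "c = k * (unit_ball_vol DIM('a) * (\<delta> * \<rho>) ^ DIM('a))"
  have "0 < c" using k \<delta> \<rho> by (simp add: c_def)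
  moreover have "0 < r0 / \<rho>" using r0 \<rho> by simp
  moreover have "c \<le> kernel_mass S K h x" if h: "0 < h" "h \<le> r0 / \<rho>" and x: "x \<in> S" for h x
  proof -
    obtain y where y: "ball y (\<delta> * (\<rho> * h)) \<subseteq> S \<inter> cball x (\<rho> * h)"
      using fat[OF x, of "\<rho> * h"] h \<rho> by (auto simp: field_simps)
    have "c = k / h ^ DIM('a) * measure lborel (ball y (\<delta> * (\<rho> * h)))"
      using \<delta> \<rho> h by (simp add: content_ball c_def power_mult_distrib)
    also have "\<dots> = (LINT a:ball y (\<delta> * (\<rho> * h))|lborel. k / h ^ DIM('a))"
      unfolding set_lebesgue_integral_def by (simp add: mult.commute)
    also have "\<dots> \<le> kernel_mass S K h x"
      unfolding kernel_mass_def set_lebesgue_integral_def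
    proof (rule integral_mono)
      show "integrable lborel (\<lambda>a. indicator (ball y (\<delta> * (\<rho> * h))) a *\<^sub>R (k / h ^ DIM('a)))"
        by (intro integrable_scaleR_left integrable_real_indicator emeasure_lborel_ball_finite) simp
      show "integrable lborel (\<lambda>a. indicat_real S a *\<^sub>R scaled_kernel K h x a)"
        using scaled_kernel_set_integrable[OF K S(1)] by (simp add: set_integrable_def)
      show "indicator (ball y (\<delta> * (\<rho> * h))) a *\<^sub>R (k / h ^ DIM('a))
          \<le> indicat_real S a *\<^sub>R scaled_kernel K h x a" for a
      proof (cases "a \<in> ball y (\<delta> * (\<rho> * h))")
        case True
        hence a: "a \<in> S" "dist x a \<le> \<rho> * h" using y by auto
        have "norm ((a - x) /\<^sub>R h) = dist x a / h"
          using h by (simp add: dist_norm norm_minus_commute divide_inverse mult.commute)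
        hence "norm ((a - x) /\<^sub>R h) \<le> \<rho>"
          using a(2) h by (simp only: pos_divide_le_eq)
        thus ?thesis using True a h k(2) by (simp add: scaled_kernel_def divide_right_mono)
      next
        case False
        thus ?thesis using scaled_kernel_nonneg[OF K h(1)] by (simp add: indicator_def)
      qed
    qed
    finally show ?thesis .
  qed
  ultimately show ?thesis using that by blast
qed

text \<open>The three quantitative properties of the normalised kernel, uniform over \<open>S\<close> and over small
bandwidths. The power of \<open>h\<close> in the Lipschitz bound is far from sharp: the constant enters only
through its logarithm, in the size of a covering net, so any power will do.\<close>

definition kappa_estimates :: "'a::euclidean_space set \<Rightarrow> ('a \<Rightarrow> real) \<Rightarrow> real \<Rightarrow> real \<Rightarrow> bool" where
  "kappa_estimates S K C h0 \<longleftrightarrow> 0 < C \<and> 0 < h0 \<and> (\<forall>h x. 0 < h \<and> h \<le> h0 \<and> x \<in> S \<longrightarrow>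
    0 < kernel_mass S K h x \<and> (\<forall>y. kappa S K h x y \<le> C / h ^ DIM('a)) \<and>
    (\<forall>x'\<in>S. \<forall>y. \<bar>kappa S K h x y - kappa S K h x' y\<bar> \<le> C / h ^ (2 * DIM('a) + 1) * dist x x'))"

lemma kappa_estimatesD:
  assumes "kappa_estimates (S :: 'a::euclidean_space set) K C h0"
  shows "0 < C" "0 < h0"
    and "\<And>h x. \<lbrakk>0 < h; h \<le> h0; x \<in> S\<rbrakk> \<Longrightarrow> 0 < kernel_mass S K h x"
    and "\<And>h x y. \<lbrakk>0 < h; h \<le> h0; x \<in> S\<rbrakk> \<Longrightarrow> kappa S K h x y \<le> C / h ^ DIM('a)"
    and "\<And>h x x' y. \<lbrakk>0 < h; h \<le> h0; x \<in> S; x' \<in> S\<rbrakk> \<Longrightarrow>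
      \<bar>kappa S K h x y - kappa S K h x' y\<bar> \<le> C / h ^ (2 * DIM('a) + 1) * dist x x'"
  using assms unfolding kappa_estimates_def by blast+

lemma kappa_estimates_exist:
  fixes S :: "'a::euclidean_space set"
  assumes K: "admissible_kernel K" and S: "compact S" "fat S"
  obtains C h0 where "kappa_estimates S K C h0"
proof -
  obtain c h1 where c: "0 < c" and h1: "0 < h1" and mass:
    "\<And>h x. \<lbrakk>0 < h; h \<le> h1; x \<in> S\<rbrakk> \<Longrightarrow> c \<le> kernel_mass S K h x"
    using kernel_mass_ge_if_fat[OF K S] by metis
  obtain B where B: "0 < B" "\<And>x. K x \<le> B"
    using K unfolding admissible_kernel_def bounded_pos by (auto simp: abs_le_iff)
  obtain l where l: "l-lipschitz_on UNIV K" using K unfolding admissible_kernel_def by blast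
  have l0: "0 \<le> l" using l by (rule lipschitz_on_nonneg)
  define d where "d = DIM('a)"
  define v where "v = measure lborel S"
  have v: "0 \<le> v" by (simp add: v_def)
  define h0 where "h0 = min h1 1"
  define C where "C = B / c + l / c + B * v * l / c\<^sup>2"
  have C: "B / c \<le> C" "l / c + B * v * l / c\<^sup>2 \<le> C" "0 < C"
    using B c v l0 by (auto simp: C_def intro!: add_pos_nonneg)
  have sk: "\<bar>scaled_kernel K h x y - scaled_kernel K h x' y\<bar> \<le> l / h ^ (d + 1) * dist x x'"
    if h: "0 < h" for h x x' y
  proof -
    have "\<bar>K ((y - x) /\<^sub>R h) - K ((y - x') /\<^sub>R h)\<bar> \<le> l * dist ((y - x) /\<^sub>R h) ((y - x') /\<^sub>R h)"
      using lipschitz_onD[OF l, of "(y - x) /\<^sub>R h" "(y - x') /\<^sub>R h"] by (simp add: dist_real_def)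
    also have "dist ((y - x) /\<^sub>R h) ((y - x') /\<^sub>R h) = dist x x' / h"
      using h by (simp add: dist_norm norm_minus_commute divide_inverse algebra_simps flip: scaleR_diff_right)
    finally have "\<bar>K ((y - x) /\<^sub>R h) - K ((y - x') /\<^sub>R h)\<bar> / h ^ d \<le> l * (dist x x' / h) / h ^ d"
      using h by (intro divide_right_mono) auto
    thus ?thesis using h by (simp add: scaled_kernel_def d_def field_simps flip: diff_divide_distrib)
  qed
  have sk_le: "scaled_kernel K h x y \<le> B / h ^ d" if "0 < h" for h x y
    using that B by (simp add: scaled_kernel_def d_def divide_right_mono)
  have km: "\<bar>kernel_mass S K h x - kernel_mass S K h x'\<bar> \<le> v * (l / h ^ (d + 1) * dist x x')"
    if h: "0 < h" for h x x'
  proof -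
    have int: "set_integrable lborel S (scaled_kernel K h x)" for x
      by (rule scaled_kernel_set_integrable[OF K S(1)])
    have "kernel_mass S K h x - kernel_mass S K h x' =
        (LINT y:S|lborel. scaled_kernel K h x y - scaled_kernel K h x' y)"
      unfolding kernel_mass_def using int by (simp add: set_integral_diff)
    hence "\<bar>kernel_mass S K h x - kernel_mass S K h x'\<bar> \<le>
        (LINT y:S|lborel. \<bar>scaled_kernel K h x y - scaled_kernel K h x' y\<bar>)"
      using set_integral_norm_bound[OF set_integral_diff(1)[OF int int], of x x'] by simp
    also have "\<dots> \<le> (LINT y:S|lborel. l / h ^ (d + 1) * dist x x')"
    proof (rule set_integral_mono)
      show "set_integrable lborel S (\<lambda>y. \<bar>scaled_kernel K h x y - scaled_kernel K h x' y\<bar>)"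
        using int by (intro set_integrable_abs set_integral_diff)
      show "set_integrable lborel S (\<lambda>y. l / h ^ (d + 1) * dist x x')"
        unfolding set_integrable_def using S(1) by (intro borel_integrable_compact) auto
    qed (rule sk[OF h])
    also have "\<dots> = v * (l / h ^ (d + 1) * dist x x')"
      unfolding set_lebesgue_integral_def v_def using S(1) by (simp add: borel_compact)
    finally show ?thesis .
  qed
  have h0: "0 < h0" using h1 by (simp add: h0_def)
  have pos: "0 < kernel_mass S K h x" if "0 < h" "h \<le> h0" "x \<in> S" for h x
    using mass[of h x] that c by (simp add: h0_def)
  have upper: "kappa S K h x y \<le> C / h ^ DIM('a)" if "0 < h" "h \<le> h0" "x \<in> S" for h x y
  proof -
    have "kappa S K h x y \<le> (B / h ^ d) / c"
      unfolding kappa_def using that mass[of h x] sk_le[of h x y] c B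
      by (intro frac_le) (auto simp: h0_def)
    also have "\<dots> = (B / c) / h ^ d" by simp
    also have "\<dots> \<le> C / h ^ d" using C that by (intro divide_right_mono) auto
    finally show ?thesis by (simp add: d_def)
  qed
  have lip: "\<bar>kappa S K h x y - kappa S K h x' y\<bar> \<le> C / h ^ (2 * DIM('a) + 1) * dist x x'"
    if h: "0 < h" "h \<le> h0" and x: "x \<in> S" "x' \<in> S" for h x x' y
  proof -
    define s s' m m' where "s = scaled_kernel K h x y" and "s' = scaled_kernel K h x' y"
      and "m = kernel_mass S K h x" and "m' = kernel_mass S K h x'"
    have m: "c \<le> m" "c \<le> m'" using mass h x by (auto simp: m_def m'_def h0_def)
    have hd: "0 < h ^ d" "h ^ d \<le> 1" using h power_le_one[of h d] by (auto simp: h0_def)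
    have s': "0 \<le> s'" "s' \<le> B / h ^ d"
      using scaled_kernel_nonneg[OF K h(1)] sk_le[OF h(1)] by (auto simp: s'_def)
    \<comment> \<open>quotient rule: vary the kernel first, then its mass\<close>
    have "s / m - s' / m' = (s - s') / m + s' * (m' - m) / (m * m')"
      using m c by (simp add: field_simps)
    also have "\<bar>\<dots>\<bar> \<le> \<bar>s - s'\<bar> / m + s' * \<bar>m' - m\<bar> / (m * m')"
      using m c s' by (intro order_trans[OF abs_triangle_ineq]) (simp add: abs_mult)
    also have "\<dots> \<le> (l / h ^ (d + 1) * dist x x') / c
        + (B / h ^ d) * (v * (l / h ^ (d + 1) * dist x x')) / (c * c)"
      using m c s' sk[OF h(1), of x y x'] km[OF h(1), of x' x] v l0 h
      by (intro add_mono frac_le mult_mono mult_nonneg_nonneg)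
         (auto simp: s_def s'_def m_def m'_def dist_commute)
    also have "\<dots> \<le> (l / c) * (1 / h ^ (2*d+1) * dist x x')
        + (B * v * l / c\<^sup>2) * (1 / h ^ (2*d+1) * dist x x')"
    proof (rule add_mono)
      have "h ^ (2*d+1) \<le> h ^ (d+1)" using h by (intro power_decreasing) (auto simp: h0_def)
      hence "1 / h ^ (d+1) \<le> 1 / h ^ (2*d+1)" using h by (intro divide_left_mono) auto
      hence "l / c * (1 / h ^ (d+1) * dist x x') \<le> l / c * (1 / h ^ (2*d+1) * dist x x')"
        using l0 c by (intro mult_left_mono mult_right_mono) auto
      thus "(l / h ^ (d + 1) * dist x x') / c \<le> (l / c) * (1 / h ^ (2*d+1) * dist x x')"
        by (simp only: times_divide_eq_left times_divide_eq_right mult.left_commute mult.commute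
            mult_1_left mult_1_right divide_divide_eq_left)
      have "h ^ (2*d+1) = h ^ d * h ^ (d+1)" by (simp only: mult_2 power_add mult.assoc)
      thus "(B / h ^ d) * (v * (l / h ^ (d + 1) * dist x x')) / (c * c)
          \<le> (B * v * l / c\<^sup>2) * (1 / h ^ (2*d+1) * dist x x')"
        by (simp only: power2_eq_square) (simp add: mult_ac)
    qed
    also have "\<dots> = (l / c + B * v * l / c\<^sup>2) * (1 / h ^ (2*d+1) * dist x x')"
      by (rule distrib_right[symmetric])
    also have "\<dots> \<le> C * (1 / h ^ (2*d+1) * dist x x')"
      using C h by (intro mult_right_mono) auto
    finally show ?thesis by (simp add: kappa_def s_def s'_def m_def m'_def d_def)
  qed
  have "kappa_estimates S K C h0"
    unfolding kappa_estimates_def using C(3) h0 pos upper lip by blast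
  thus ?thesis by (rule that)
qed

section \<open>Uniform concentration of averages\<close>

text \<open>For negative \<open>x = - y\<close>, the product of the Taylor lower bound for \<open>exp y\<close> with \<open>1 - y + y\<^sup>2\<close>
is at least one.\<close>

lemma exp_le_quadratic:
  fixes x :: real
  assumes "x \<le> 1"
  shows "exp x \<le> 1 + x + x\<^sup>2"
proof (cases "0 \<le> x")
  case True
  thus ?thesis using exp_bound[of x] assms by simp
next
  case False
  define y where "y = - x"
  have y: "0 < y" using False by (simp add: y_def)
  have "1 \<le> (1 + y + y\<^sup>2 / 2) * (1 - y + y\<^sup>2)"
  proof -
    have "(1 + y + y\<^sup>2 / 2) * (1 - y + y\<^sup>2) = 1 + (y^2/2 + y^3/2 + y^4/2)"
      by (simp add: field_simps power2_eq_square power3_eq_cube power4_eq_xxxx)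
    thus ?thesis using y by simp
  qed
  also have "\<dots> \<le> exp y * (1 - y + y\<^sup>2)"
  proof (rule mult_right_mono)
    show "1 + y + y\<^sup>2 / 2 \<le> exp y" using y by (intro exp_lower_Taylor_quadratic) simp
    have "1 - y + y\<^sup>2 = (1/2 - y)\<^sup>2 + 3/4" by (simp add: power2_eq_square algebra_simps)
    thus "0 \<le> 1 - y + y\<^sup>2" by simp
  qed
  finally have "exp x \<le> exp x * (exp y * (1 - y + y\<^sup>2))" by simp
  also have "\<dots> = 1 + x + x\<^sup>2"
    by (simp add: y_def exp_minus field_simps)
  finally show ?thesis .
qed

context prob_space
begin

text \<open>A Bernstein bound in the form that keeps the free parameter \<open>s\<close>. The condition \<open>s b \<le> 1\<close> is what
allows the exponential to be replaced by a quadratic polynomial, and then only the second moment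
\<open>v\<close> is left. For the summands of the numerator this matters, because \<open>b\<close> carries the truncation
level while \<open>v\<close> does not: a bound in terms of \<open>b\<^sup>2\<close> would be too weak.\<close>

lemma chernoff_sum_ge:
  fixes Y :: "'i \<Rightarrow> 'a \<Rightarrow> real" and a b s v :: real
  assumes I: "finite I" and indep: "indep_vars (\<lambda>_. borel) Y I"
    and bnd: "\<And>i x. i \<in> I \<Longrightarrow> x \<in> space M \<Longrightarrow> \<bar>Y i x\<bar> \<le> b"
    and mean: "\<And>i. i \<in> I \<Longrightarrow> expectation (Y i) = 0"
    and second: "\<And>i. i \<in> I \<Longrightarrow> expectation (\<lambda>x. (Y i x)\<^sup>2) \<le> v"
    and s: "0 < s" "s * b \<le> 1"
  shows "prob {x\<in>space M. a \<le> (\<Sum>i\<in>I. Y i x)} \<le> exp (card I * (s\<^sup>2 * v) - s * a)"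
proof -
  have meas: "Y i \<in> borel_measurable M" if "i \<in> I" for i
    using indep that unfolding indep_vars_def by auto
  note meas[measurable]
  have "ennreal (prob {x\<in>space M. a \<le> (\<Sum>i\<in>I. Y i x)}) = emeasure M {x\<in>space M. a \<le> (\<Sum>i\<in>I. Y i x)}"
    by (simp add: emeasure_eq_measure)
  also have "\<dots> \<le> ennreal (exp (- s * a)) * (\<integral>\<^sup>+x\<in>space M. exp (s * (\<Sum>i\<in>I. Y i x)) \<partial>M)"
    by (intro Chernoff_ineq_nn_integral_ge s) auto
  also have "(\<integral>\<^sup>+x\<in>space M. exp (s * (\<Sum>i\<in>I. Y i x)) \<partial>M) =
      (\<integral>\<^sup>+x. (\<Prod>i\<in>I. ennreal (exp (s * Y i x))) \<partial>M)"
    by (intro nn_integral_cong) (simp_all add: sum_distrib_left exp_sum I prod_ennreal)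
  also have "\<dots> = (\<Prod>i\<in>I. \<integral>\<^sup>+x. ennreal (exp (s * Y i x)) \<partial>M)"
    by (intro indep_vars_nn_integral I indep_vars_compose2[OF indep]) auto
  also have "ennreal (exp (- s * a)) * \<dots> \<le> ennreal (exp (- s * a)) * (\<Prod>i\<in>I. ennreal (exp (s\<^sup>2 * v)))"
  proof (intro mult_left_mono prod_mono_ennreal)
    fix i assume i: "i \<in> I"
    have int: "integrable M (Y i)" "integrable M (\<lambda>x. (Y i x)\<^sup>2)"
    proof -
      show "integrable M (Y i)"
        using bnd[OF i] meas[OF i] by (intro integrable_const_bound[where B = b]) auto
      have "\<bar>Y i x\<bar>\<^sup>2 \<le> b\<^sup>2" if "x \<in> space M" for x
        using bnd[OF i that] by (intro power_mono) auto
      thus "integrable M (\<lambda>x. (Y i x)\<^sup>2)"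
        using meas[OF i] by (intro integrable_const_bound[where B = "b\<^sup>2"]) auto
    qed
    have quad: "exp (s * Y i x) \<le> 1 + s * Y i x + s\<^sup>2 * (Y i x)\<^sup>2" if "x \<in> space M" for x
    proof -
      have "s * Y i x \<le> s * b" using bnd[OF i that] s by (intro mult_left_mono) auto
      hence "s * Y i x \<le> 1" using s by linarith
      thus ?thesis using exp_le_quadratic[of "s * Y i x"] by (simp add: power_mult_distrib)
    qed
    have "(\<integral>\<^sup>+x. ennreal (exp (s * Y i x)) \<partial>M) \<le> (\<integral>\<^sup>+x. ennreal (1 + s * Y i x + s\<^sup>2 * (Y i x)\<^sup>2) \<partial>M)"
      by (intro nn_integral_mono ennreal_leI quad)
    also have "\<dots> = ennreal (expectation (\<lambda>x. 1 + s * Y i x + s\<^sup>2 * (Y i x)\<^sup>2))"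
    proof (rule nn_integral_eq_integral)
      show "AE x in M. 0 \<le> 1 + s * Y i x + s\<^sup>2 * (Y i x)\<^sup>2"
        using quad by (intro AE_I2) (meson exp_ge_zero order_trans)
    qed (use int in auto)
    also have "expectation (\<lambda>x. 1 + s * Y i x + s\<^sup>2 * (Y i x)\<^sup>2) = 1 + s\<^sup>2 * expectation (\<lambda>x. (Y i x)\<^sup>2)"
      using int mean[OF i] by (simp add: prob_space)
    also have "ennreal \<dots> \<le> ennreal (exp (s\<^sup>2 * v))"
    proof (rule ennreal_leI)
      have "s\<^sup>2 * expectation (\<lambda>x. (Y i x)\<^sup>2) \<le> s\<^sup>2 * v"
        using second[OF i] by (intro mult_left_mono) auto
      thus "1 + s\<^sup>2 * expectation (\<lambda>x. (Y i x)\<^sup>2) \<le> exp (s\<^sup>2 * v)"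
        using exp_ge_add_one_self[of "s\<^sup>2 * v"] by linarith
    qed
    finally show "(\<integral>\<^sup>+x. ennreal (exp (s * Y i x)) \<partial>M) \<le> ennreal (exp (s\<^sup>2 * v))" .
  qed auto
  also have "\<dots> = ennreal (exp (card I * (s\<^sup>2 * v) - s * a))"
    by (simp add: ennreal_power exp_diff exp_minus divide_inverse mult.commute
        flip: ennreal_mult exp_of_nat_mult)
  finally show ?thesis by (subst (asm) ennreal_le_iff) simp_all
qed

text \<open>For values in \<open>[0, b]\<close>, centring keeps the absolute bound \<open>b\<close> and does not increase the second
moment, so the one-sided bound applies to the centred variables and to their negatives.\<close>

lemma chernoff_sum_deviation:
  fixes X :: "'i \<Rightarrow> 'a \<Rightarrow> real" and a b m s v :: real
  assumes I: "finite I" and indep: "indep_vars (\<lambda>_. borel) X I"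
    and bnd: "\<And>i x. i \<in> I \<Longrightarrow> x \<in> space M \<Longrightarrow> 0 \<le> X i x \<and> X i x \<le> b"
    and mean: "\<And>i. i \<in> I \<Longrightarrow> expectation (X i) = m"
    and second: "\<And>i. i \<in> I \<Longrightarrow> expectation (\<lambda>x. (X i x)\<^sup>2) \<le> v"
    and s: "0 < s" "s * b \<le> 1"
  shows "prob {x\<in>space M. a \<le> \<bar>(\<Sum>i\<in>I. X i x) - card I * m\<bar>} \<le> 2 * exp (card I * (s\<^sup>2 * v) - s * a)"
proof -
  have meas: "X i \<in> borel_measurable M" if "i \<in> I" for i
    using indep that unfolding indep_vars_def by auto
  note meas[measurable]
  have int: "integrable M (X i)" "integrable M (\<lambda>x. (X i x)\<^sup>2)" if i: "i \<in> I" for i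
  proof -
    show "integrable M (X i)"
      using bnd[OF i] meas[OF i] by (intro integrable_const_bound[where B = b]) auto
    have "\<bar>X i x\<bar>\<^sup>2 \<le> b\<^sup>2" if "x \<in> space M" for x
      using bnd[OF i that] by (intro power_mono) auto
    thus "integrable M (\<lambda>x. (X i x)\<^sup>2)"
      using meas[OF i] by (intro integrable_const_bound[where B = "b\<^sup>2"]) auto
  qed
  have m: "0 \<le> m \<and> m \<le> b" if i: "i \<in> I" for i
  proof
    show "0 \<le> m" unfolding mean[OF i, symmetric]
      using bnd[OF i] by (intro integral_nonneg_AE AE_I2) auto
    show "m \<le> b" unfolding mean[OF i, symmetric]
      using bnd[OF i] int[OF i] by (intro integral_le_const AE_I2) auto
  qed
  have var: "expectation (\<lambda>x. (X i x - m)\<^sup>2) \<le> v" if i: "i \<in> I" for i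
  proof -
    have "expectation (\<lambda>x. (X i x - m)\<^sup>2) = expectation (\<lambda>x. (X i x)\<^sup>2) - m\<^sup>2"
      using variance_eq[OF int(1)[OF i] int(2)[OF i]] mean[OF i] by simp
    thus ?thesis using second[OF i] zero_le_power2[of m] by linarith
  qed
  have bd: "\<bar>X i x - m\<bar> \<le> b" if "i \<in> I" "x \<in> space M" for i x
    using bnd[OF that] m[OF that(1)] by linarith
  define U where "U = {x\<in>space M. a \<le> (\<Sum>i\<in>I. X i x - m)}"
  define W where "W = {x\<in>space M. a \<le> (\<Sum>i\<in>I. - (X i x - m))}"
  have U: "prob U \<le> exp (card I * (s\<^sup>2 * v) - s * a)" unfolding U_def
  proof (rule chernoff_sum_ge[OF I _ bd _ var s])
    show "indep_vars (\<lambda>_. borel) (\<lambda>i x. X i x - m) I"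
      by (rule indep_vars_compose2[OF indep]) simp
    show "expectation (\<lambda>x. X i x - m) = 0" if "i \<in> I" for i
      using int[OF that] mean[OF that] by (simp add: prob_space)
  qed
  have W: "prob W \<le> exp (card I * (s\<^sup>2 * v) - s * a)" unfolding W_def
  proof (rule chernoff_sum_ge[OF I _ _ _ _ s])
    show "indep_vars (\<lambda>_. borel) (\<lambda>i x. - (X i x - m)) I"
      by (rule indep_vars_compose2[OF indep]) simp
    show "expectation (\<lambda>x. - (X i x - m)) = 0" if "i \<in> I" for i
      using int[OF that] mean[OF that] by (simp add: prob_space)
    show "expectation (\<lambda>x. (- (X i x - m))\<^sup>2) \<le> v" if "i \<in> I" for i
      using var[OF that] by (simp add: power2_commute)
    show "\<bar>- (X i x - m)\<bar> \<le> b" if "i \<in> I" "x \<in> space M" for i x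
      using bd[OF that] by linarith
  qed
  have eq: "{x\<in>space M. a \<le> \<bar>(\<Sum>i\<in>I. X i x) - card I * m\<bar>} = U \<union> W"
    by (auto simp: U_def W_def sum_subtractf sum_negf abs_real_def split: if_splits)
  have "prob (U \<union> W) \<le> prob U + prob W"
    unfolding U_def W_def by (intro measure_Un_le) measurable
  thus ?thesis unfolding eq using U W by linarith
qed

end

text \<open>Choose one point of \<open>Q\<close> from each nonempty cell of the grid of mesh \<open>1 / m\<close>. Choosing
representatives inside \<open>Q\<close>, and not the grid points, keeps the net in the index set.\<close>

lemma bounded_grid_net:
  fixes Q :: "'q::euclidean_space set"
  assumes "bounded Q"
  obtains R where "0 < R"
    "\<And>m::nat. 1 \<le> m \<Longrightarrow> \<exists>N. finite N \<and> N \<subseteq> Q \<and> real (card N) \<le> R * real m ^ DIM('q) \<and>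
       (\<forall>q\<in>Q. \<exists>q'\<in>N. dist q q' \<le> DIM('q) / m)"
proof -
  obtain B where B: "0 < B" "\<And>q. q \<in> Q \<Longrightarrow> norm q \<le> B"
    using assms unfolding bounded_pos by blast
  define k where "k = nat \<lceil>B\<rceil> + 1"
  have k: "B \<le> real k - 1" "1 \<le> k" using B by (auto simp: k_def)
  define R where "R = real ((2 * k + 1) ^ DIM('q))"
  have "\<exists>N. finite N \<and> N \<subseteq> Q \<and> real (card N) \<le> R * real m ^ DIM('q) \<and>
       (\<forall>q\<in>Q. \<exists>q'\<in>N. dist q q' \<le> DIM('q) / m)" if m: "1 \<le> m" for m :: nat
  proof -
    define g where "g q = (\<lambda>b\<in>Basis. \<lfloor>real m * (q \<bullet> b)\<rfloor>)" for q :: 'q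
    define T where "T = (\<Pi>\<^sub>E b\<in>(Basis::'q set). {- int (k*m) .. int (k*m)})"
    have T: "finite T" "card T = (2 * (k * m) + 1) ^ DIM('q)"
      by (simp_all add: T_def finite_PiE card_PiE nat_add_distrib nat_mult_distrib)
    have gT: "g ` Q \<subseteq> T"
    proof clarify
      fix q assume q: "q \<in> Q"
      have "\<lfloor>real m * (q \<bullet> b)\<rfloor> \<in> {- int (k*m) .. int (k*m)}" if b: "b \<in> Basis" for b
      proof -
        have "\<bar>q \<bullet> b\<bar> \<le> real k" using Basis_le_norm[OF b, of q] B(2)[OF q] k by linarith
        hence "real m * \<bar>q \<bullet> b\<bar> \<le> real m * real k" by (intro mult_left_mono) auto
        hence "\<bar>real m * (q \<bullet> b)\<bar> \<le> real k * real m" by (simp add: abs_mult mult.commute)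
        thus ?thesis by (auto simp: le_floor_iff floor_le_iff abs_le_iff)
      qed
      thus "g q \<in> T" by (auto simp: g_def T_def)
    qed
    define N where "N = inv_into Q g ` g ` Q"
    have fin: "finite (g ` Q)" using gT T finite_subset by blast
    have "card N \<le> card T"
      unfolding N_def using card_image_le[OF fin] card_mono[OF T(1) gT] order_trans by blast
    also have "\<dots> \<le> ((2 * k + 1) * m) ^ DIM('q)"
      unfolding T using m by (intro power_mono) (auto simp: algebra_simps)
    finally have "real (card N) \<le> real (((2 * k + 1) * m) ^ DIM('q))" by (rule of_nat_mono)
    hence "real (card N) \<le> R * real m ^ DIM('q)" by (simp only: R_def power_mult_distrib of_nat_mult of_nat_power)
    moreover have "N \<subseteq> Q" unfolding N_def by (auto intro: inv_into_into)
    moreover have "\<exists>q'\<in>N. dist q q' \<le> DIM('q) / m" if q: "q \<in> Q" for q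
    proof
      let ?q = "inv_into Q g (g q)"
      show "?q \<in> N" using q by (auto simp: N_def)
      have "g ?q = g q" using q by (simp add: f_inv_into_f)
      hence fl: "\<lfloor>real m * (?q \<bullet> b)\<rfloor> = \<lfloor>real m * (q \<bullet> b)\<rfloor>" if "b \<in> Basis" for b
        using that by (metis (no_types, lifting) g_def restrict_apply')
      have "\<bar>(q - ?q) \<bullet> b\<bar> \<le> 1 / m" if "b \<in> Basis" for b
      proof -
        have "\<bar>real m * (q \<bullet> b) - real m * (?q \<bullet> b)\<bar> \<le> 1" using fl[OF that] by linarith
        hence "real m * \<bar>(q - ?q) \<bullet> b\<bar> \<le> 1"
          by (simp add: inner_diff_left abs_mult flip: right_diff_distrib)
        thus ?thesis using m by (simp add: field_simps)
      qed
      hence "(\<Sum>b\<in>Basis. \<bar>(q - ?q) \<bullet> b\<bar>) \<le> (\<Sum>b\<in>(Basis::'q set). 1 / m)" by (intro sum_mono) auto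
      thus "dist q ?q \<le> DIM('q) / m" using norm_le_l1[of "q - ?q"] by (simp add: dist_norm)
    qed
    moreover have "finite N" unfolding N_def using fin by (rule finite_imageI)
    ultimately show ?thesis by blast
  qed
  moreover have "0 < R" by (simp add: R_def)
  ultimately show ?thesis using that by blast
qed


text \<open>A uniform law of large numbers for a family that changes with the sample size. With
\<open>s = 2 \<theta> ln n / (n \<epsilon>)\<close>, the rate conditions on \<open>b\<close> and \<open>v\<close> turn the Bernstein bound at a single
index into twice \<open>n\<close> to the power \<open>1 - \<theta>\<close>. A polynomial Lipschitz constant allows a net of
polynomial size that loses only \<open>O(1/n)\<close>, and \<open>\<theta>\<close> is taken large enough for the union bound over
this net. The exceptional sets \<open>B n\<close> are events although the supremum over \<open>Q\<close> need not be
measurable.\<close>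

lemma (in prob_space) uniform_concentration:
  fixes X :: "nat \<Rightarrow> 'a \<Rightarrow> 'x" and Q :: "'q::euclidean_space set"
    and f :: "nat \<Rightarrow> 'x \<Rightarrow> 'q \<Rightarrow> real" and b v :: "nat \<Rightarrow> real"
  assumes indep: "indep_vars (\<lambda>_. N) X {1..}"
    and X0: "X0 \<in> M \<rightarrow>\<^sub>M N" and ident: "\<And>i. 1 \<le> i \<Longrightarrow> distr M N (X i) = distr M N X0"
    and Q: "bounded Q" and \<epsilon>: "0 < \<epsilon>"
    and meas: "\<And>n q. 1 \<le> n \<Longrightarrow> q \<in> Q \<Longrightarrow> (\<lambda>x. f n x q) \<in> borel_measurable N"
    and bnd: "\<forall>\<^sub>F n in sequentially. \<forall>x\<in>space N. \<forall>q\<in>Q. 0 \<le> f n x q \<and> f n x q \<le> b n"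
    and second: "\<forall>\<^sub>F n in sequentially. \<forall>q\<in>Q. expectation (\<lambda>\<omega>. (f n (X0 \<omega>) q)\<^sup>2) \<le> v n"
    and lip: "\<forall>\<^sub>F n in sequentially. \<forall>x\<in>space N. \<forall>q\<in>Q. \<forall>q'\<in>Q.
                \<bar>f n x q - f n x q'\<bar> \<le> real n ^ k * dist q q'"
    and b: "(\<lambda>n. b n * ln (real n) / real n) \<longlonglongrightarrow> 0"
    and v: "(\<lambda>n. v n * ln (real n) / real n) \<longlonglongrightarrow> 0"
  obtains B :: "nat \<Rightarrow> 'a set" where "\<And>n. B n \<in> events" "(\<lambda>n. prob (B n)) \<longlonglongrightarrow> 0"
    "\<forall>\<^sub>F n in sequentially. \<forall>\<omega>\<in>space M - B n. \<forall>q\<in>Q.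
       \<bar>(\<Sum>i=1..n. f n (X i \<omega>) q) / n - expectation (\<lambda>\<omega>. f n (X0 \<omega>) q)\<bar> \<le> \<epsilon>"
proof -
  obtain R where R: "0 < R" and net:
    "\<And>m::nat. 1 \<le> m \<Longrightarrow> \<exists>N. finite N \<and> N \<subseteq> Q \<and> real (card N) \<le> R * real m ^ DIM('q) \<and>
       (\<forall>q\<in>Q. \<exists>q'\<in>N. dist q q' \<le> DIM('q) / m)"
    using bounded_grid_net[OF Q] by metis
  define d where "d = DIM('q)"
  have "\<forall>n. \<exists>T. 1 \<le> n \<longrightarrow> finite T \<and> T \<subseteq> Q \<and> real (card T) \<le> R * real n ^ ((k+1) * d) \<and>
       (\<forall>q\<in>Q. \<exists>q'\<in>T. dist q q' \<le> d / real n ^ (k+1))"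
  proof
    fix n :: nat
    show "\<exists>T. 1 \<le> n \<longrightarrow> finite T \<and> T \<subseteq> Q \<and> real (card T) \<le> R * real n ^ ((k+1) * d) \<and>
       (\<forall>q\<in>Q. \<exists>q'\<in>T. dist q q' \<le> d / real n ^ (k+1))"
      using net[of "n ^ (k+1)"] unfolding d_def power_mult by (cases "1 \<le> n") auto
  qed
  then obtain T where T: "\<And>n. 1 \<le> n \<Longrightarrow> finite (T n)" "\<And>n. 1 \<le> n \<Longrightarrow> T n \<subseteq> Q"
      "\<And>n. 1 \<le> n \<Longrightarrow> real (card (T n)) \<le> R * real n ^ ((k+1) * d)"
      "\<And>n q. 1 \<le> n \<Longrightarrow> q \<in> Q \<Longrightarrow> \<exists>q'\<in>T n. dist q q' \<le> d / real n ^ (k+1)"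
    by metis
  have rv: "X i \<in> M \<rightarrow>\<^sub>M N" if "1 \<le> i" for i
    using indep that unfolding indep_vars_def by auto
  define dev where "dev n q \<omega> = \<bar>(\<Sum>i\<in>{1..n}. f n (X i \<omega>) q) - real n * expectation (\<lambda>\<omega>. f n (X0 \<omega>) q)\<bar>"
    for n q \<omega>
  have f_rv: "(\<lambda>\<omega>. f n (X i \<omega>) q) \<in> borel_measurable M" if "1 \<le> i" "1 \<le> n" "q \<in> Q" for i n q
    using measurable_compose[OF rv[OF that(1)] meas[OF that(2,3)]] by simp
  have f_rv0: "(\<lambda>\<omega>. f n (X0 \<omega>) q) \<in> borel_measurable M" if "1 \<le> n" "q \<in> Q" for n q
    using measurable_compose[OF X0 meas[OF that]] by simp
  have dev_rv: "dev n q \<in> borel_measurable M" if "1 \<le> n" "q \<in> Q" for n q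
    unfolding dev_def[abs_def] using f_rv[OF _ that]
    by (intro borel_measurable_abs borel_measurable_diff borel_measurable_sum) auto
  \<comment> \<open>half of \<open>\<epsilon>\<close> is kept for passing from the net to all of \<open>Q\<close>, in the average and in the mean\<close>
  define E where "E n q = {\<omega>\<in>space M. real n * \<epsilon> / 2 \<le> dev n q \<omega>}" for n q
  have E: "E n q \<in> events" if "1 \<le> n" "q \<in> Q" for n q
    unfolding E_def using dev_rv[OF that] by measurable
  define B where "B n = (if 1 \<le> n then (\<Union>q\<in>T n. E n q) else {})" for n
  \<comment> \<open>the exponent of the net size, plus one for the second-moment term of the Bernstein bound
      and one for the decay\<close>
  define \<theta> where "\<theta> = real ((k+1) * d + 2)"
  have \<theta>: "2 \<le> \<theta>" by (simp add: \<theta>_def)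
  have e1: "\<forall>\<^sub>F n in sequentially. b n * ln (real n) / real n \<le> \<epsilon> / (2 * \<theta>)"
    using order_tendstoD(2)[OF b, of "\<epsilon> / (2 * \<theta>)"] \<epsilon> \<theta> by (auto elim!: eventually_mono)
  have e2: "\<forall>\<^sub>F n in sequentially. v n * ln (real n) / real n \<le> \<epsilon>\<^sup>2 / (4 * \<theta>\<^sup>2)"
    using order_tendstoD(2)[OF v, of "\<epsilon>\<^sup>2 / (4 * \<theta>\<^sup>2)"] \<epsilon> \<theta> by (auto elim!: eventually_mono)
  have prob_E: "prob (E n q) \<le> 2 / real n ^ ((k+1) * d + 1)"
    if n: "2 \<le> n" and q: "q \<in> Q"
      and b': "b n * ln (real n) / real n \<le> \<epsilon> / (2 * \<theta>)"
      and v': "v n * ln (real n) / real n \<le> \<epsilon>\<^sup>2 / (4 * \<theta>\<^sup>2)"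
      and bnd': "\<forall>x\<in>space N. \<forall>q\<in>Q. 0 \<le> f n x q \<and> f n x q \<le> b n"
      and second': "\<forall>q\<in>Q. expectation (\<lambda>\<omega>. (f n (X0 \<omega>) q)\<^sup>2) \<le> v n" for n q
  proof -
    have n1: "1 \<le> n" using n by simp
    define s where "s = 2 * \<theta> * ln (real n) / (real n * \<epsilon>)"
    have ln: "0 < ln (real n)" using n by simp
    have s: "0 < s" using ln n \<epsilon> \<theta> by (simp add: s_def)
    have "s * b n = (2 * \<theta> / \<epsilon>) * (b n * ln (real n) / real n)" by (simp add: s_def mult_ac)
    also have "\<dots> \<le> (2 * \<theta> / \<epsilon>) * (\<epsilon> / (2 * \<theta>))" using b' \<epsilon> \<theta> by (intro mult_left_mono) auto
    also have "\<dots> = 1" using \<epsilon> \<theta> by simp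
    finally have sb: "s * b n \<le> 1" .
    have "real n * (s\<^sup>2 * v n) = (4 * \<theta>\<^sup>2 / \<epsilon>\<^sup>2) * (v n * ln (real n) / real n) * ln (real n)"
      using n by (simp add: s_def power2_eq_square field_simps)
    also have "\<dots> \<le> (4 * \<theta>\<^sup>2 / \<epsilon>\<^sup>2) * (\<epsilon>\<^sup>2 / (4 * \<theta>\<^sup>2)) * ln (real n)"
      using v' \<epsilon> \<theta> ln by (intro mult_left_mono mult_right_mono) auto
    also have "\<dots> = ln (real n)" using \<epsilon> \<theta> by simp
    finally have sv: "real n * (s\<^sup>2 * v n) \<le> ln (real n)" .
    have sa: "s * (real n * \<epsilon> / 2) = \<theta> * ln (real n)" using n \<epsilon> by (simp add: s_def)
    have eq: "expectation (\<lambda>\<omega>. g (X i \<omega>)) = expectation (\<lambda>\<omega>. g (X0 \<omega>))"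
      if "1 \<le> i" "g \<in> borel_measurable N" for i and g :: "'x \<Rightarrow> real"
      using integral_distr[OF rv[OF that(1)] that(2)] integral_distr[OF X0 that(2)] ident[OF that(1)]
      by simp
    have "E n q = {\<omega>\<in>space M. real n * \<epsilon> / 2 \<le>
        \<bar>(\<Sum>i\<in>{1..n}. f n (X i \<omega>) q) - real (card {1..n}) * expectation (\<lambda>\<omega>. f n (X0 \<omega>) q)\<bar>}"
      by (simp add: E_def dev_def)
    also have "prob \<dots> \<le> 2 * exp (real (card {1..n}) * (s\<^sup>2 * v n) - s * (real n * \<epsilon> / 2))"
    proof (rule chernoff_sum_deviation[OF _ _ _ _ _ s sb])
      show "indep_vars (\<lambda>_. borel) (\<lambda>i \<omega>. f n (X i \<omega>) q) {1..n}"
        using indep_vars_compose2[OF indep_vars_subset[OF indep], of "{1..n}" "\<lambda>_ x. f n x q" "\<lambda>_. borel"]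
          meas[OF n1 q] by auto
      show "0 \<le> f n (X i x) q \<and> f n (X i x) q \<le> b n" if "i \<in> {1..n}" "x \<in> space M" for i x
        using bnd' q measurable_space[OF rv] that by auto
      show "expectation (\<lambda>\<omega>. f n (X i \<omega>) q) = expectation (\<lambda>\<omega>. f n (X0 \<omega>) q)" if "i \<in> {1..n}" for i
        using eq[OF _ meas[OF n1 q]] that by simp
      show "expectation (\<lambda>\<omega>. (f n (X i \<omega>) q)\<^sup>2) \<le> v n" if "i \<in> {1..n}" for i
      proof -
        have "(\<lambda>x. (f n x q)\<^sup>2) \<in> borel_measurable N" using meas[OF n1 q] by measurable
        thus ?thesis using eq[of i "\<lambda>x. (f n x q)\<^sup>2"] that second' q by simp
      qed
    qed simp
    also have "\<dots> \<le> 2 * exp (ln (real n) - \<theta> * ln (real n))" using sv sa by simp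
    also have "ln (real n) - \<theta> * ln (real n) = - (real ((k+1) * d + 1) * ln (real n))"
      by (simp add: \<theta>_def algebra_simps)
    also have "2 * exp \<dots> = 2 / real n ^ ((k+1) * d + 1)"
      using n by (subst exp_minus, subst exp_of_nat_mult) (simp add: divide_inverse)
    finally show ?thesis .
  qed
  have "\<forall>\<^sub>F n in sequentially. prob (B n) \<le> 2 * R * (1 / real n)"
    using e1 e2 bnd second eventually_ge_at_top[of 2]
  proof eventually_elim
    case (elim n)
    have n1: "1 \<le> n" using elim by simp
    have "prob (B n) \<le> (\<Sum>q\<in>T n. prob (E n q))"
      using n1 T(1,2)[OF n1] E[OF n1] unfolding B_def
      by (auto intro!: finite_measure_subadditive_finite)
    also have "\<dots> \<le> (\<Sum>q\<in>T n. 2 / real n ^ ((k+1) * d + 1))"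
      using elim T(2)[OF n1] by (intro sum_mono prob_E) auto
    also have "\<dots> = real (card (T n)) * (2 / real n ^ ((k+1) * d + 1))" by simp
    also have "\<dots> \<le> (R * real n ^ ((k+1) * d)) * (2 / real n ^ ((k+1) * d + 1))"
      by (intro mult_right_mono T(3) n1) auto
    also have "\<dots> = 2 * R * (1 / real n)" using n1 by (simp add: field_simps)
    finally show ?case .
  qed
  moreover have "(\<lambda>n. 2 * R * (1 / real n)) \<longlonglongrightarrow> 0"
    using tendsto_mult_right_zero[OF lim_1_over_n] by simp
  ultimately have lim: "(\<lambda>n. prob (B n)) \<longlonglongrightarrow> 0"
    by (rule tendsto_sandwich[OF always_eventually[OF allI[OF measure_nonneg]] _ tendsto_const])
  have "(\<lambda>n. real d * (1 / real n)) \<longlonglongrightarrow> 0"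
    using tendsto_mult_right_zero[OF lim_1_over_n] by simp
  hence e3: "\<forall>\<^sub>F n in sequentially. real d * (1 / real n) < \<epsilon> / 4"
    using \<epsilon> by (intro order_tendstoD(2)) auto
  have good: "\<forall>\<^sub>F n in sequentially. \<forall>\<omega>\<in>space M - B n. \<forall>q\<in>Q.
       \<bar>(\<Sum>i=1..n. f n (X i \<omega>) q) / n - expectation (\<lambda>\<omega>. f n (X0 \<omega>) q)\<bar> \<le> \<epsilon>"
    using e3 bnd lip eventually_ge_at_top[of 1]
  proof eventually_elim
    case (elim n)
    show ?case
    proof (intro ballI)
      fix \<omega> q assume \<omega>: "\<omega> \<in> space M - B n" and q: "q \<in> Q"
      obtain q' where q': "q' \<in> T n" "dist q q' \<le> d / real n ^ (k+1)" using T(4) elim q by blast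
      have q'Q: "q' \<in> Q" using T(2) elim q' by blast
      have close: "\<bar>f n x q - f n x q'\<bar> \<le> \<epsilon> / 4" if "x \<in> space N" for x
      proof -
        have "\<bar>f n x q - f n x q'\<bar> \<le> real n ^ k * dist q q'" using elim that q q'Q by blast
        also have "\<dots> \<le> real n ^ k * (d / real n ^ (k+1))" using q' by (intro mult_left_mono) auto
        also have "\<dots> = real d * (1 / real n)" using elim by simp
        finally show ?thesis using elim(1) by linarith
      qed
      have int: "integrable M (\<lambda>\<omega>. f n (X0 \<omega>) r)" if "r \<in> Q" for r
      proof (rule integrable_const_bound[where B = "b n"])
        show "AE \<omega> in M. norm (f n (X0 \<omega>) r) \<le> b n"
        proof (rule AE_I2)
          fix \<omega> assume "\<omega> \<in> space M"
          hence "0 \<le> f n (X0 \<omega>) r \<and> f n (X0 \<omega>) r \<le> b n"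
            using elim(2) that measurable_space[OF X0] by blast
          thus "norm (f n (X0 \<omega>) r) \<le> b n" by simp
        qed
      qed (rule f_rv0[OF elim(4) that])
      have "\<bar>expectation (\<lambda>\<omega>. f n (X0 \<omega>) q) - expectation (\<lambda>\<omega>. f n (X0 \<omega>) q')\<bar>
          = \<bar>expectation (\<lambda>\<omega>. f n (X0 \<omega>) q - f n (X0 \<omega>) q')\<bar>"
        using int q q'Q by simp
      also have "\<dots> \<le> expectation (\<lambda>\<omega>. \<bar>f n (X0 \<omega>) q - f n (X0 \<omega>) q'\<bar>)"
        by (rule integral_abs_bound)
      also have "\<dots> \<le> \<epsilon> / 4"
        by (intro integral_le_const AE_I2 close measurable_space[OF X0] integrable_abs
            Bochner_Integration.integrable_diff int q q'Q)
      finally have ex: "\<bar>expectation (\<lambda>\<omega>. f n (X0 \<omega>) q) - expectation (\<lambda>\<omega>. f n (X0 \<omega>) q')\<bar> \<le> \<epsilon> / 4" .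
      have n: "0 < real n" using elim by simp
      have "\<bar>(\<Sum>i=1..n. f n (X i \<omega>) q) - (\<Sum>i=1..n. f n (X i \<omega>) q')\<bar>
          = \<bar>\<Sum>i=1..n. f n (X i \<omega>) q - f n (X i \<omega>) q'\<bar>" by (simp add: sum_subtractf)
      also have "\<dots> \<le> (\<Sum>i=1..n. \<bar>f n (X i \<omega>) q - f n (X i \<omega>) q'\<bar>)" by (rule sum_abs)
      also have "\<dots> \<le> (\<Sum>i=1..n. \<epsilon> / 4)"
        using \<omega> by (intro sum_mono close measurable_space[OF rv]) auto
      finally have su: "\<bar>(\<Sum>i=1..n. f n (X i \<omega>) q) - (\<Sum>i=1..n. f n (X i \<omega>) q')\<bar> \<le> n * (\<epsilon> / 4)"
        by simp
      have "\<omega> \<notin> E n q'" using \<omega> q' elim by (auto simp: B_def)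
      hence de: "\<bar>(\<Sum>i=1..n. f n (X i \<omega>) q') - real n * expectation (\<lambda>\<omega>. f n (X0 \<omega>) q')\<bar> < real n * \<epsilon> / 2"
        using \<omega> by (auto simp: E_def dev_def)
      have "\<bar>real n * expectation (\<lambda>\<omega>. f n (X0 \<omega>) q) - real n * expectation (\<lambda>\<omega>. f n (X0 \<omega>) q')\<bar>
          = real n * \<bar>expectation (\<lambda>\<omega>. f n (X0 \<omega>) q) - expectation (\<lambda>\<omega>. f n (X0 \<omega>) q')\<bar>"
        by (subst right_diff_distrib[symmetric], subst abs_mult) simp
      also have "\<dots> \<le> real n * (\<epsilon> / 4)" using ex by (rule mult_left_mono) simp
      finally have "\<bar>(\<Sum>i=1..n. f n (X i \<omega>) q) - real n * expectation (\<lambda>\<omega>. f n (X0 \<omega>) q)\<bar> \<le> real n * \<epsilon>"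
        using su de by linarith
      hence "\<bar>(\<Sum>i=1..n. f n (X i \<omega>) q) - real n * expectation (\<lambda>\<omega>. f n (X0 \<omega>) q)\<bar> / n \<le> \<epsilon>"
        using n by (simp only: pos_divide_le_eq mult.commute)
      moreover have "(\<Sum>i=1..n. f n (X i \<omega>) q) / n - expectation (\<lambda>\<omega>. f n (X0 \<omega>) q) =
          ((\<Sum>i=1..n. f n (X i \<omega>) q) - real n * expectation (\<lambda>\<omega>. f n (X0 \<omega>) q)) / n"
        using n by (simp add: diff_divide_distrib)
      ultimately show "\<bar>(\<Sum>i=1..n. f n (X i \<omega>) q) / n - expectation (\<lambda>\<omega>. f n (X0 \<omega>) q)\<bar> \<le> \<epsilon>"
        using n by (simp add: abs_divide)
    qed
  qed
  have "B n \<in> events" for n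
  proof (cases "1 \<le> n")
    case True
    have "E n q \<in> events" if "q \<in> T n" for q
      using E[OF True] T(2)[OF True] that by (simp add: subset_eq)
    hence "(\<Union>q\<in>T n. E n q) \<in> events" using T(1)[OF True] by (intro sets.finite_UN)
    thus ?thesis using True by (simp add: B_def)
  qed (simp add: B_def)
  from that[OF this lim good] show ?thesis .
qed

section \<open>Conditional means of random measures\<close>

lemma borel_measurable_congI:
  assumes "\<And>a. a \<in> space T \<Longrightarrow> f a = g a" "g \<in> borel_measurable T"
  shows "f \<in> borel_measurable T"
  using assms measurable_cong[of T f g borel] by blast

text \<open>The counting measure of a random diagram may be infinite, which rules out the measurable space of
subprobability measures. Measurability of the evaluations on sets is extended to integrals through
simple functions and monotone convergence.\<close>

lemma measurable_nn_integral_family: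
  fixes \<mu> :: "'a \<Rightarrow> 'b measure"
  assumes sets: "\<And>a. a \<in> space T \<Longrightarrow> sets (\<mu> a) = sets B"
    and emeasure: "\<And>A. A \<in> sets B \<Longrightarrow> (\<lambda>a. emeasure (\<mu> a) A) \<in> borel_measurable T"
    and f: "f \<in> borel_measurable B"
  shows "(\<lambda>a. \<integral>\<^sup>+y. f y \<partial>\<mu> a) \<in> borel_measurable T"
proof -
  have m: "g \<in> borel_measurable (\<mu> a)" if "g \<in> borel_measurable B" "a \<in> space T" for g :: "'b \<Rightarrow> ennreal" and a
    using that measurable_cong_sets[OF sets refl] by blast
  have sp: "space (\<mu> a) = space B" if "a \<in> space T" for a
    using sets[OF that] by (rule sets_eq_imp_space_eq)
  show ?thesis
    using f
  proof (induction rule: borel_measurable_induct)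
    case (cong f g)
    have "(\<integral>\<^sup>+y. f y \<partial>\<mu> a) = (\<integral>\<^sup>+y. g y \<partial>\<mu> a)" if "a \<in> space T" for a
      using cong sp[OF that] by (intro nn_integral_cong) auto
    thus ?case using cong.IH by (rule borel_measurable_congI)
  next
    case (set A)
    have "(\<integral>\<^sup>+y. indicator A y \<partial>\<mu> a) = emeasure (\<mu> a) A" if "a \<in> space T" for a
      using set sets[OF that] by simp
    thus ?case using emeasure[OF set] by (rule borel_measurable_congI)
  next
    case (mult u c)
    have "(\<integral>\<^sup>+y. c * u y \<partial>\<mu> a) = c * (\<integral>\<^sup>+y. u y \<partial>\<mu> a)" if "a \<in> space T" for a
      by (rule nn_integral_cmult, rule m, rule mult, rule that)
    thus ?case using borel_measurable_times_ennreal[OF borel_measurable_const mult.IH]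
      by (rule borel_measurable_congI)
  next
    case (add u v)
    have "(\<integral>\<^sup>+y. v y + u y \<partial>\<mu> a) = (\<integral>\<^sup>+y. v y \<partial>\<mu> a) + (\<integral>\<^sup>+y. u y \<partial>\<mu> a)" if "a \<in> space T" for a
      by (rule nn_integral_add; rule m; (rule add that)?)
    thus ?case using borel_measurable_add[OF add.IH(2,1)] by (rule borel_measurable_congI)
  next
    case (seq U)
    have "(\<integral>\<^sup>+y. (SUP i. U i) y \<partial>\<mu> a) = (SUP i. \<integral>\<^sup>+y. U i y \<partial>\<mu> a)" if "a \<in> space T" for a
      unfolding SUP_apply
      by (rule nn_integral_monotone_convergence_SUP[OF seq.hyps(3)], rule m, rule seq, rule that)
    thus ?case using borel_measurable_SUP[OF countableI_type seq.IH] by (rule borel_measurable_congI)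
  qed
qed

lemma nn_integral_cond_exp_version:
  assumes P: "prob_space P" and Z: "Z \<in> P \<rightarrow>\<^sub>M N" and X: "cond_exp_version P N Z X g"
    and \<phi>: "\<phi> \<in> borel_measurable N"
  shows "(\<integral>\<^sup>+\<omega>. \<phi> (Z \<omega>) * X \<omega> \<partial>P) = (\<integral>\<^sup>+\<omega>. \<phi> (Z \<omega>) * g (Z \<omega>) \<partial>P)"
proof -
  interpret prob_space P by fact
  let ?F = "vimage_algebra (space P) Z N"
  have sub: "subalgebra P ?F"
    unfolding subalgebra_def using measurable_sets[OF Z] measurable_space[OF Z]
    by (auto simp: sets_vimage_algebra2)
  interpret finite_measure_subalgebra P ?F
    by unfold_locales (rule sub)
  have X': "X \<in> borel_measurable P" and ae: "AE \<omega> in P. nn_cond_exp P ?F X \<omega> = g (Z \<omega>)"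
    using X by (auto simp: cond_exp_version_def)
  have "Z \<in> ?F \<rightarrow>\<^sub>M N"
    using measurable_space[OF Z] by (intro measurable_vimage_algebra1) auto
  hence \<phi>Z: "(\<lambda>\<omega>. \<phi> (Z \<omega>)) \<in> borel_measurable ?F" using \<phi> by (rule measurable_compose)
  have "(\<integral>\<^sup>+\<omega>. \<phi> (Z \<omega>) * X \<omega> \<partial>P) = (\<integral>\<^sup>+\<omega>. \<phi> (Z \<omega>) * nn_cond_exp P ?F X \<omega> \<partial>P)"
    using nn_cond_exp_intg[OF \<phi>Z X'] by simp
  also have "\<dots> = (\<integral>\<^sup>+\<omega>. \<phi> (Z \<omega>) * g (Z \<omega>) \<partial>P)"
    using ae by (intro nn_integral_cong_AE) auto
  finally show ?thesis .
qed

text \<open>The conditional means are given set by set, with exceptional null sets that depend on the set.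
Integrating against a function \<open>\<phi>\<close> of the conditioning variable removes the null sets, and the
identity then passes from indicators to all nonnegative functions by monotone convergence. The
argument works with the measures \<open>\<nu> z\<close>, because their densities are controlled for each \<open>z\<close>
separately.\<close>

lemma nn_integral_cond_exp_version_family:
  fixes \<mu> :: "'w \<Rightarrow> 'y measure" and \<nu> :: "'z \<Rightarrow> 'y measure"
  assumes P: "prob_space P" and Z: "Z \<in> P \<rightarrow>\<^sub>M N" and \<phi>: "\<phi> \<in> borel_measurable N"
    and \<mu>: "\<And>\<omega>. \<omega> \<in> space P \<Longrightarrow> sets (\<mu> \<omega>) = sets B"
    and \<nu>: "\<And>z. z \<in> space N \<Longrightarrow> sets (\<nu> z) = sets B"
    and cond: "\<And>A. A \<in> sets B \<Longrightarrow>
      cond_exp_version P N Z (\<lambda>\<omega>. emeasure (\<mu> \<omega>) A) (\<lambda>z. emeasure (\<nu> z) A)"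
    and f: "f \<in> borel_measurable B"
  shows "(\<integral>\<^sup>+\<omega>. \<phi> (Z \<omega>) * (\<integral>\<^sup>+y. f y \<partial>\<mu> \<omega>) \<partial>P) = (\<integral>\<^sup>+\<omega>. \<phi> (Z \<omega>) * (\<integral>\<^sup>+y. f y \<partial>\<nu> (Z \<omega>)) \<partial>P)"
proof -
  have sp\<mu>: "space (\<mu> \<omega>) = space B" if "\<omega> \<in> space P" for \<omega>
    using \<mu>[OF that] by (rule sets_eq_imp_space_eq)
  have ZN: "Z \<omega> \<in> space N" if "\<omega> \<in> space P" for \<omega>
    using measurable_space[OF Z that] .
  have sp\<nu>: "space (\<nu> (Z \<omega>)) = space B" if "\<omega> \<in> space P" for \<omega>
    using \<nu>[OF ZN[OF that]] by (rule sets_eq_imp_space_eq)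
  have m\<mu>: "g \<in> borel_measurable (\<mu> \<omega>)" and m\<nu>: "g \<in> borel_measurable (\<nu> (Z \<omega>))"
    if "g \<in> borel_measurable B" "\<omega> \<in> space P" for g :: "'y \<Rightarrow> ennreal" and \<omega>
    using that measurable_cong_sets[OF \<mu> refl] measurable_cong_sets[OF \<nu> refl] ZN by blast+
  have i\<mu>: "(\<lambda>\<omega>. \<phi> (Z \<omega>) * (\<integral>\<^sup>+y. g y \<partial>\<mu> \<omega>)) \<in> borel_measurable P"
    and i\<nu>: "(\<lambda>\<omega>. \<phi> (Z \<omega>) * (\<integral>\<^sup>+y. g y \<partial>\<nu> (Z \<omega>))) \<in> borel_measurable P"
    if g: "g \<in> borel_measurable B" for g :: "'y \<Rightarrow> ennreal"
  proof -
    have "(\<lambda>\<omega>. \<integral>\<^sup>+y. g y \<partial>\<mu> \<omega>) \<in> borel_measurable P"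
      by (rule measurable_nn_integral_family[OF \<mu> _ g]) (use cond in \<open>auto simp: cond_exp_version_def\<close>)
    moreover have "(\<lambda>z. \<integral>\<^sup>+y. g y \<partial>\<nu> z) \<in> borel_measurable N"
      by (rule measurable_nn_integral_family[OF \<nu> _ g]) (use cond in \<open>auto simp: cond_exp_version_def\<close>)
    ultimately show "(\<lambda>\<omega>. \<phi> (Z \<omega>) * (\<integral>\<^sup>+y. g y \<partial>\<mu> \<omega>)) \<in> borel_measurable P"
        "(\<lambda>\<omega>. \<phi> (Z \<omega>) * (\<integral>\<^sup>+y. g y \<partial>\<nu> (Z \<omega>))) \<in> borel_measurable P"
      using Z \<phi> by (auto intro!: borel_measurable_times_ennreal intro: measurable_compose)
  qed
  show ?thesis
    using f
  proof (induction rule: borel_measurable_induct)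
    case (cong f g)
    have e1: "(\<integral>\<^sup>+y. f y \<partial>\<mu> \<omega>) = (\<integral>\<^sup>+y. g y \<partial>\<mu> \<omega>)"
      and e2: "(\<integral>\<^sup>+y. f y \<partial>\<nu> (Z \<omega>)) = (\<integral>\<^sup>+y. g y \<partial>\<nu> (Z \<omega>))"
      if "\<omega> \<in> space P" for \<omega>
      by (rule nn_integral_cong, rule cong, simp only: sp\<mu> sp\<nu> that)+
    have "(\<integral>\<^sup>+\<omega>. \<phi> (Z \<omega>) * (\<integral>\<^sup>+y. f y \<partial>\<mu> \<omega>) \<partial>P) = (\<integral>\<^sup>+\<omega>. \<phi> (Z \<omega>) * (\<integral>\<^sup>+y. g y \<partial>\<mu> \<omega>) \<partial>P)"
      by (rule nn_integral_cong) (simp only: e1)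
    also note cong.IH
    also have "(\<integral>\<^sup>+\<omega>. \<phi> (Z \<omega>) * (\<integral>\<^sup>+y. g y \<partial>\<nu> (Z \<omega>)) \<partial>P) = (\<integral>\<^sup>+\<omega>. \<phi> (Z \<omega>) * (\<integral>\<^sup>+y. f y \<partial>\<nu> (Z \<omega>)) \<partial>P)"
      by (rule nn_integral_cong) (simp only: e2)
    finally show ?case .
  next
    case (set A)
    have e1: "(\<integral>\<^sup>+y. indicator A y \<partial>\<mu> \<omega>) = emeasure (\<mu> \<omega>) A"
      and e2: "(\<integral>\<^sup>+y. indicator A y \<partial>\<nu> (Z \<omega>)) = emeasure (\<nu> (Z \<omega>)) A" if "\<omega> \<in> space P" for \<omega>
      using set \<mu>[OF that] \<nu>[OF ZN[OF that]] by simp_all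
    have "(\<integral>\<^sup>+\<omega>. \<phi> (Z \<omega>) * (\<integral>\<^sup>+y. indicator A y \<partial>\<mu> \<omega>) \<partial>P) = (\<integral>\<^sup>+\<omega>. \<phi> (Z \<omega>) * emeasure (\<mu> \<omega>) A \<partial>P)"
      by (rule nn_integral_cong) (simp only: e1)
    also note nn_integral_cond_exp_version[OF P Z cond[OF set] \<phi>]
    also have "(\<integral>\<^sup>+\<omega>. \<phi> (Z \<omega>) * emeasure (\<nu> (Z \<omega>)) A \<partial>P) = (\<integral>\<^sup>+\<omega>. \<phi> (Z \<omega>) * (\<integral>\<^sup>+y. indicator A y \<partial>\<nu> (Z \<omega>)) \<partial>P)"
      by (rule nn_integral_cong) (simp only: e2)
    finally show ?case .
  next
    case (mult u c)
    have e1: "(\<integral>\<^sup>+y. c * u y \<partial>\<mu> \<omega>) = c * (\<integral>\<^sup>+y. u y \<partial>\<mu> \<omega>)"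
      and e2: "(\<integral>\<^sup>+y. c * u y \<partial>\<nu> (Z \<omega>)) = c * (\<integral>\<^sup>+y. u y \<partial>\<nu> (Z \<omega>))" if "\<omega> \<in> space P" for \<omega>
      by (rule nn_integral_cmult, rule m\<mu> m\<nu>, rule mult, rule that)+
    have "(\<integral>\<^sup>+\<omega>. \<phi> (Z \<omega>) * (\<integral>\<^sup>+y. c * u y \<partial>\<mu> \<omega>) \<partial>P) = (\<integral>\<^sup>+\<omega>. c * (\<phi> (Z \<omega>) * (\<integral>\<^sup>+y. u y \<partial>\<mu> \<omega>)) \<partial>P)"
      by (rule nn_integral_cong) (simp only: e1 mult.left_commute)
    also have "\<dots> = c * (\<integral>\<^sup>+\<omega>. \<phi> (Z \<omega>) * (\<integral>\<^sup>+y. u y \<partial>\<mu> \<omega>) \<partial>P)"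
      by (rule nn_integral_cmult, rule i\<mu>, rule mult)
    also have "\<dots> = c * (\<integral>\<^sup>+\<omega>. \<phi> (Z \<omega>) * (\<integral>\<^sup>+y. u y \<partial>\<nu> (Z \<omega>)) \<partial>P)"
      by (simp only: mult.IH)
    also have "\<dots> = (\<integral>\<^sup>+\<omega>. c * (\<phi> (Z \<omega>) * (\<integral>\<^sup>+y. u y \<partial>\<nu> (Z \<omega>))) \<partial>P)"
      by (rule nn_integral_cmult[symmetric], rule i\<nu>, rule mult)
    also have "\<dots> = (\<integral>\<^sup>+\<omega>. \<phi> (Z \<omega>) * (\<integral>\<^sup>+y. c * u y \<partial>\<nu> (Z \<omega>)) \<partial>P)"
      by (rule nn_integral_cong) (simp only: e2 mult.left_commute)
    finally show ?case .
  next
    case (add u v)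
    have e1: "(\<integral>\<^sup>+y. v y + u y \<partial>\<mu> \<omega>) = (\<integral>\<^sup>+y. v y \<partial>\<mu> \<omega>) + (\<integral>\<^sup>+y. u y \<partial>\<mu> \<omega>)"
      and e2: "(\<integral>\<^sup>+y. v y + u y \<partial>\<nu> (Z \<omega>)) = (\<integral>\<^sup>+y. v y \<partial>\<nu> (Z \<omega>)) + (\<integral>\<^sup>+y. u y \<partial>\<nu> (Z \<omega>))"
      if "\<omega> \<in> space P" for \<omega>
      by (rule nn_integral_add; rule m\<mu> m\<nu>; (rule add that)?)+
    have "(\<integral>\<^sup>+\<omega>. \<phi> (Z \<omega>) * (\<integral>\<^sup>+y. v y + u y \<partial>\<mu> \<omega>) \<partial>P)
        = (\<integral>\<^sup>+\<omega>. \<phi> (Z \<omega>) * (\<integral>\<^sup>+y. v y \<partial>\<mu> \<omega>) + \<phi> (Z \<omega>) * (\<integral>\<^sup>+y. u y \<partial>\<mu> \<omega>) \<partial>P)"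
      by (rule nn_integral_cong) (simp only: e1 distrib_left)
    also have "\<dots> = (\<integral>\<^sup>+\<omega>. \<phi> (Z \<omega>) * (\<integral>\<^sup>+y. v y \<partial>\<mu> \<omega>) \<partial>P) + (\<integral>\<^sup>+\<omega>. \<phi> (Z \<omega>) * (\<integral>\<^sup>+y. u y \<partial>\<mu> \<omega>) \<partial>P)"
      by (rule nn_integral_add; rule i\<mu>; rule add)
    also have "\<dots> = (\<integral>\<^sup>+\<omega>. \<phi> (Z \<omega>) * (\<integral>\<^sup>+y. v y \<partial>\<nu> (Z \<omega>)) \<partial>P) + (\<integral>\<^sup>+\<omega>. \<phi> (Z \<omega>) * (\<integral>\<^sup>+y. u y \<partial>\<nu> (Z \<omega>)) \<partial>P)"
      by (simp only: add.IH)
    also have "\<dots> = (\<integral>\<^sup>+\<omega>. \<phi> (Z \<omega>) * (\<integral>\<^sup>+y. v y \<partial>\<nu> (Z \<omega>)) + \<phi> (Z \<omega>) * (\<integral>\<^sup>+y. u y \<partial>\<nu> (Z \<omega>)) \<partial>P)"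
      by (rule nn_integral_add[symmetric]; rule i\<nu>; rule add)
    also have "\<dots> = (\<integral>\<^sup>+\<omega>. \<phi> (Z \<omega>) * (\<integral>\<^sup>+y. v y + u y \<partial>\<nu> (Z \<omega>)) \<partial>P)"
      by (rule nn_integral_cong) (simp only: e2 distrib_left)
    finally show ?case .
  next
    case (seq U)
    have e1: "(\<integral>\<^sup>+y. (SUP i. U i) y \<partial>\<mu> \<omega>) = (SUP i. \<integral>\<^sup>+y. U i y \<partial>\<mu> \<omega>)"
      and e2: "(\<integral>\<^sup>+y. (SUP i. U i) y \<partial>\<nu> (Z \<omega>)) = (SUP i. \<integral>\<^sup>+y. U i y \<partial>\<nu> (Z \<omega>))" if "\<omega> \<in> space P" for \<omega>
      unfolding SUP_apply
      by (rule nn_integral_monotone_convergence_SUP[OF seq.hyps(3)], rule m\<mu> m\<nu>, rule seq, rule that)+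
    have inc: "incseq (\<lambda>i \<omega>. \<phi> (Z \<omega>) * (\<integral>\<^sup>+y. U i y \<partial>\<mu> \<omega>))"
      "incseq (\<lambda>i \<omega>. \<phi> (Z \<omega>) * (\<integral>\<^sup>+y. U i y \<partial>\<nu> (Z \<omega>)))"
      using seq.hyps(3) by (auto simp: incseq_def le_fun_def intro!: mult_left_mono nn_integral_mono)
    have "(\<integral>\<^sup>+\<omega>. \<phi> (Z \<omega>) * (\<integral>\<^sup>+y. (SUP i. U i) y \<partial>\<mu> \<omega>) \<partial>P)
        = (\<integral>\<^sup>+\<omega>. (SUP i. \<phi> (Z \<omega>) * (\<integral>\<^sup>+y. U i y \<partial>\<mu> \<omega>)) \<partial>P)"
      by (rule nn_integral_cong) (simp only: e1 SUP_mult_left_ennreal)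
    also have "\<dots> = (SUP i. \<integral>\<^sup>+\<omega>. \<phi> (Z \<omega>) * (\<integral>\<^sup>+y. U i y \<partial>\<mu> \<omega>) \<partial>P)"
      by (rule nn_integral_monotone_convergence_SUP[OF inc(1)], rule i\<mu>, rule seq)
    also have "\<dots> = (SUP i. \<integral>\<^sup>+\<omega>. \<phi> (Z \<omega>) * (\<integral>\<^sup>+y. U i y \<partial>\<nu> (Z \<omega>)) \<partial>P)"
      by (simp only: seq.IH)
    also have "\<dots> = (\<integral>\<^sup>+\<omega>. (SUP i. \<phi> (Z \<omega>) * (\<integral>\<^sup>+y. U i y \<partial>\<nu> (Z \<omega>))) \<partial>P)"
      by (rule nn_integral_monotone_convergence_SUP[OF inc(2), symmetric], rule i\<nu>, rule seq)
    also have "\<dots> = (\<integral>\<^sup>+\<omega>. \<phi> (Z \<omega>) * (\<integral>\<^sup>+y. (SUP i. U i) y \<partial>\<nu> (Z \<omega>)) \<partial>P)"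
      by (rule nn_integral_cong) (simp only: e2 SUP_mult_left_ennreal)
    finally show ?case .
  qed
qed

section \<open>Truncated diagrams\<close>

lemma space_diagram_space: "space (diagram_space L) = diagrams L"
  unfolding diagram_space_def by (rule space_measure_of) auto

lemma sets_diagram_measure [simp]: "sets (diagram_measure L a) = sets (borel_bar L)"
  by (simp add: diagram_measure_def)

lemma measurable_emeasure_diagram_measure:
  assumes A: "A \<in> sets (borel_bar L)"
  shows "(\<lambda>a. emeasure (diagram_measure L a) A) \<in> borel_measurable (diagram_space L)"
proof (rule measurableI)
  fix B :: "ennreal set" assume B: "B \<in> sets borel"
  have "(\<lambda>a. emeasure (diagram_measure L a) A) -` B \<inter> space (diagram_space L) =
      {a \<in> diagrams L. emeasure (diagram_measure L a) A \<in> B}"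
    by (auto simp: space_diagram_space)
  also have "\<dots> \<in> sets (diagram_space L)"
    unfolding diagram_space_def using A B by (intro in_measure_of) auto
  finally show "(\<lambda>a. emeasure (diagram_measure L a) A) -` B \<inter> space (diagram_space L)
      \<in> sets (diagram_space L)" .
qed simp

lemma sets_weighted_measure [simp]: "sets (weighted_measure L w a) = sets (borel_bar L)"
  by (simp add: weighted_measure_def)

lemma space_weighted_measure [simp]: "space (weighted_measure L w a) = Omega_bar L"
  using sets_eq_imp_space_eq[OF sets_weighted_measure[of L w a]] by (simp add: space_restrict_space)

lemma Omega_bar_sets_borel_bar: "Omega_bar L \<in> sets (borel_bar L)"
  using sets.top[of "borel_bar L"] by (simp add: space_restrict_space)

lemma measurable_emeasure_weighted_measure:
  assumes w: "weight L w" and A: "A \<in> sets (borel_bar L)"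
  shows "(\<lambda>a. emeasure (weighted_measure L w a) A) \<in> borel_measurable (diagram_space L)"
proof -
  have wm: "w \<in> borel_measurable (borel_bar L)" using w by (simp add: weight_def)
  have "(\<lambda>a. \<integral>\<^sup>+v. ennreal (w v) * indicator A v \<partial>diagram_measure L a) \<in> borel_measurable (diagram_space L)"
    using wm A by (intro measurable_nn_integral_family[where B = "borel_bar L"]
        measurable_emeasure_diagram_measure) auto
  moreover have "emeasure (weighted_measure L w a) A = (\<integral>\<^sup>+v. ennreal (w v) * indicator A v \<partial>diagram_measure L a)" for a
    unfolding weighted_measure_def using wm A
    by (intro emeasure_density) (simp_all add: measurable_cong_sets[OF sets_diagram_measure refl])
  ultimately show ?thesis by simp
qed

lemma measurable_total_mass:
  assumes "weight L w"
  shows "total_mass L w \<in> borel_measurable (diagram_space L)"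
  unfolding total_mass_def[abs_def]
  by (rule measurable_emeasure_weighted_measure[OF assms Omega_bar_sets_borel_bar])

text \<open>The truncation acts on the whole diagram: one that is too heavy is discarded, not thinned. The
total mass is therefore at most \<open>M\<close> for every diagram, and the estimator is unchanged on the
event that no sampled diagram is too heavy.\<close>

definition truncated_measure ::
  "real \<Rightarrow> (real \<times> real \<Rightarrow> real) \<Rightarrow> real \<Rightarrow> (real \<times> real \<Rightarrow> nat) \<Rightarrow> (real \<times> real) measure" where
  "truncated_measure L w M a =
     (if total_mass L w a \<le> ennreal M then weighted_measure L w a else null_measure (borel_bar L))"

lemma sets_truncated_measure [simp]: "sets (truncated_measure L w M a) = sets (borel_bar L)"
  by (simp add: truncated_measure_def)

lemma space_truncated_measure [simp]: "space (truncated_measure L w M a) = Omega_bar L"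
  by (simp add: truncated_measure_def space_restrict_space)

lemma emeasure_truncated_measure:
  "emeasure (truncated_measure L w M a) A =
     emeasure (weighted_measure L w a) A * (if total_mass L w a \<le> ennreal M then 1 else 0)"
  by (simp add: truncated_measure_def)

lemma measurable_emeasure_truncated_measure:
  assumes w: "weight L w" and A: "A \<in> sets (borel_bar L)"
  shows "(\<lambda>a. emeasure (truncated_measure L w M a) A) \<in> borel_measurable (diagram_space L)"
proof -
  note measurable_emeasure_weighted_measure[OF assms, measurable] measurable_total_mass[OF w, measurable]
  show ?thesis unfolding emeasure_truncated_measure by measurable
qed

lemma truncated_measure_mass_le: "emeasure (truncated_measure L w M a) (Omega_bar L) \<le> ennreal M"
  by (auto simp: emeasure_truncated_measure total_mass_def)

lemma finite_measure_truncated_measure: "finite_measure (truncated_measure L w M a)"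
  using truncated_measure_mass_le[of L w M a] by (intro finite_measureI) (auto simp: top_unique)

definition truncated_smoothed ::
  "real \<Rightarrow> (real \<times> real \<Rightarrow> real) \<Rightarrow> (real \<times> real \<Rightarrow> real) \<Rightarrow> real \<Rightarrow> real \<Rightarrow>
   (real \<times> real \<Rightarrow> nat) \<Rightarrow> real \<times> real \<Rightarrow> real" where
  "truncated_smoothed L w K h M a u = (LINT v|truncated_measure L w M a. kappa (Omega_bar L) K h u v)"

lemma truncated_smoothed_eq:
  "truncated_smoothed L w K h M a u = (if total_mass L w a \<le> ennreal M then smoothed L w K h a u else 0)"
  by (simp add: truncated_smoothed_def smoothed_def truncated_measure_def)

lemma kappa_measurable_borel_bar:
  assumes "admissible_kernel K"
  shows "kappa (Omega_bar L) K h u \<in> borel_measurable (borel_bar L)"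
  by (intro measurable_restrict_space1 kappa_measurable[OF assms])

lemma kappa_measurable_truncated:
  assumes "admissible_kernel K"
  shows "kappa (Omega_bar L) K h u \<in> borel_measurable (truncated_measure L w M a)"
  using kappa_measurable_borel_bar[OF assms] measurable_cong_sets[OF sets_truncated_measure refl] by blast

lemma truncated_smoothed_enn2real:
  assumes K: "admissible_kernel K" and h: "0 < h"
  shows "truncated_smoothed L w K h M a u =
    enn2real (\<integral>\<^sup>+v. ennreal (kappa (Omega_bar L) K h u v) \<partial>truncated_measure L w M a)"
  unfolding truncated_smoothed_def
  using kappa_measurable_truncated[OF K] kappa_nonneg[OF K h] by (intro integral_eq_nn_integral) auto

lemma truncated_smoothed_nonneg:
  assumes K: "admissible_kernel K" and h: "0 < h"
  shows "0 \<le> truncated_smoothed L w K h M a u"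
  unfolding truncated_smoothed_enn2real[OF assms] by simp

lemma measurable_truncated_smoothed:
  assumes w: "weight L w" and K: "admissible_kernel K" and h: "0 < h"
  shows "(\<lambda>a. truncated_smoothed L w K h M a u) \<in> borel_measurable (diagram_space L)"
proof -
  have "(\<lambda>a. \<integral>\<^sup>+v. ennreal (kappa (Omega_bar L) K h u v) \<partial>truncated_measure L w M a)
      \<in> borel_measurable (diagram_space L)"
    using kappa_measurable_borel_bar[OF K] by (intro measurable_nn_integral_family[where B = "borel_bar L"]
        measurable_emeasure_truncated_measure[OF w]) auto
  thus ?thesis unfolding truncated_smoothed_enn2real[OF K h] by simp
qed

lemma kappa_integrable_truncated:
  assumes K: "admissible_kernel K" and h: "0 < h" and c: "\<And>v. kappa (Omega_bar L) K h u v \<le> c"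
  shows "integrable (truncated_measure L w M a) (kappa (Omega_bar L) K h u)"
proof -
  interpret finite_measure "truncated_measure L w M a" by (rule finite_measure_truncated_measure)
  show ?thesis using kappa_measurable_truncated[OF K] kappa_nonneg[OF K h] c
    by (intro integrable_const_bound[where B = c]) auto
qed

lemma measure_truncated_le:
  assumes "0 \<le> M"
  shows "measure (truncated_measure L w M a) (Omega_bar L) \<le> M"
  using truncated_measure_mass_le[of L w M a] assms unfolding measure_def
  by (intro enn2real_leI) auto

lemma integral_truncated_le:
  assumes "f \<in> borel_measurable (borel_bar L)" "\<And>v. \<bar>f v\<bar> \<le> c" "0 \<le> M"
  shows "\<bar>LINT v|truncated_measure L w M a. f v\<bar> \<le> c * M"
proof -
  interpret finite_measure "truncated_measure L w M a" by (rule finite_measure_truncated_measure)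
  have f: "f \<in> borel_measurable (truncated_measure L w M a)"
    using assms(1) measurable_cong_sets[OF sets_truncated_measure refl] by blast
  have int: "integrable (truncated_measure L w M a) f"
    using f assms(2) by (intro integrable_const_bound[where B = c]) auto
  have "0 \<le> c" using assms(2)[of undefined] by linarith
  have "\<bar>LINT v|truncated_measure L w M a. f v\<bar> \<le> (LINT v|truncated_measure L w M a. \<bar>f v\<bar>)"
    by (rule integral_abs_bound)
  also have "\<dots> \<le> (LINT v|truncated_measure L w M a. c)"
    using int assms(2) by (intro integral_mono) auto
  also have "\<dots> = measure (truncated_measure L w M a) (Omega_bar L) * c" by simp
  also have "\<dots> \<le> M * c" using measure_truncated_le[OF assms(3)] \<open>0 \<le> c\<close> by (intro mult_right_mono)
  finally show ?thesis by (simp add: mult.commute)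
qed

lemma truncated_smoothed_le:
  assumes K: "admissible_kernel K" and h: "0 < h" and c: "\<And>v. kappa (Omega_bar L) K h u v \<le> c"
    and M: "0 \<le> M"
  shows "truncated_smoothed L w K h M a u \<le> c * M"
proof -
  have "\<bar>LINT v|truncated_measure L w M a. kappa (Omega_bar L) K h u v\<bar> \<le> c * M"
    using c kappa_nonneg[OF K h] by (intro integral_truncated_le kappa_measurable_borel_bar[OF K] M) auto
  thus ?thesis unfolding truncated_smoothed_def by linarith
qed

lemma truncated_smoothed_lipschitz:
  assumes K: "admissible_kernel K" and h: "0 < h"
    and c: "\<And>v. kappa (Omega_bar L) K h u v \<le> c" "\<And>v. kappa (Omega_bar L) K h u' v \<le> c"
    and l: "\<And>v. \<bar>kappa (Omega_bar L) K h u v - kappa (Omega_bar L) K h u' v\<bar> \<le> l"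
    and M: "0 \<le> M"
  shows "\<bar>truncated_smoothed L w K h M a u - truncated_smoothed L w K h M a u'\<bar> \<le> l * M"
proof -
  have "truncated_smoothed L w K h M a u - truncated_smoothed L w K h M a u' =
      (LINT v|truncated_measure L w M a. kappa (Omega_bar L) K h u v - kappa (Omega_bar L) K h u' v)"
    unfolding truncated_smoothed_def
    using c by (intro Bochner_Integration.integral_diff[symmetric] kappa_integrable_truncated[OF K h, of _ _ c]) auto
  thus ?thesis
    using integral_truncated_le[OF borel_measurable_diff[OF kappa_measurable_borel_bar[OF K] kappa_measurable_borel_bar[OF K]] l M]
    by simp
qed

lemma ennreal_truncated_smoothed:
  assumes K: "admissible_kernel K" and h: "0 < h" and c: "\<And>v. kappa (Omega_bar L) K h u v \<le> c"
  shows "ennreal (truncated_smoothed L w K h M a u) =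
    (\<integral>\<^sup>+v. ennreal (kappa (Omega_bar L) K h u v) \<partial>truncated_measure L w M a)"
  unfolding truncated_smoothed_def
  using kappa_integrable_truncated[OF assms] kappa_nonneg[OF K h]
  by (intro nn_integral_eq_integral[symmetric]) auto

section \<open>Bias and second moment\<close>

lemma nn_integral_lebesgue_bar_kappa:
  assumes "admissible_kernel K" "0 < h" "0 < kernel_mass (Omega_bar L) K h u"
  shows "(\<integral>\<^sup>+v. ennreal (kappa (Omega_bar L) K h u v) \<partial>lebesgue_bar L) = 1"
  using nn_integral_kappa[OF assms(1) compact_Omega_bar assms(2,3)] .

text \<open>The mean is the average of the density \<open>p\<close> against the probability density \<^const>\<open>kappa\<close>.\<close>

lemma expectation_kappa_bounds:
  fixes S :: "'a::euclidean_space set"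
  assumes K: "admissible_kernel K" and S: "compact S" and h: "0 < h" "0 < kernel_mass S K h z"
    and Z: "distributed P (restrict_space lborel S) Z (\<lambda>z. ennreal (p z))"
    and p: "0 \<le> c" "\<And>z. z \<in> S \<Longrightarrow> c \<le> p z \<and> p z \<le> C"
  shows "ennreal c \<le> (\<integral>\<^sup>+\<omega>. ennreal (kappa S K h z (Z \<omega>)) \<partial>P)"
    and "(\<integral>\<^sup>+\<omega>. ennreal (kappa S K h z (Z \<omega>)) \<partial>P) \<le> ennreal C"
proof -
  let ?R = "restrict_space lborel S"
  have sp: "space ?R = S" by (simp add: space_restrict_space)
  have k: "(\<lambda>y. ennreal (kappa S K h z y)) \<in> borel_measurable ?R"
    using kappa_measurable[OF K] by (intro measurable_restrict_space1) simp
  have eq: "(\<integral>\<^sup>+\<omega>. ennreal (kappa S K h z (Z \<omega>)) \<partial>P) = (\<integral>\<^sup>+y. ennreal (p y) * ennreal (kappa S K h z y) \<partial>?R)"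
    using distributed_nn_integral[OF Z k] by simp
  have c1: "(\<integral>\<^sup>+y. ennreal a * ennreal (kappa S K h z y) \<partial>?R) = ennreal a" for a
    using k by (simp add: nn_integral_cmult nn_integral_kappa[OF K S h])
  have "(\<integral>\<^sup>+y. ennreal c * ennreal (kappa S K h z y) \<partial>?R) \<le> (\<integral>\<^sup>+y. ennreal (p y) * ennreal (kappa S K h z y) \<partial>?R)"
    using p by (intro nn_integral_mono mult_right_mono ennreal_leI) (auto simp: sp)
  thus "ennreal c \<le> (\<integral>\<^sup>+\<omega>. ennreal (kappa S K h z (Z \<omega>)) \<partial>P)" unfolding eq c1 .
  have "(\<integral>\<^sup>+y. ennreal (p y) * ennreal (kappa S K h z y) \<partial>?R) \<le> (\<integral>\<^sup>+y. ennreal C * ennreal (kappa S K h z y) \<partial>?R)"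
    using p by (intro nn_integral_mono mult_right_mono ennreal_leI) (auto simp: sp)
  thus "(\<integral>\<^sup>+\<omega>. ennreal (kappa S K h z (Z \<omega>)) \<partial>P) \<le> ennreal C" unfolding eq c1 .
qed

text \<open>The bias estimate. Conditioning on \<open>Z\<close> turns the smoothed truncated diagram into the kernel
average of the truncated intensity \<open>lt\<close>. Both kernels vanish outside their bandwidths, so only
values of \<open>lt\<close> near \<open>(z, u)\<close> contribute, and these are within \<open>\<eta>\<close> of \<open>l\<close>. The mean of the
numerator is compared with \<open>l\<close> times the mean of the denominator and not with a limit: the
factor \<open>m\<close> absorbs the density of \<open>Z\<close>, which cancels in the ratio.\<close>

lemma numerator_mean_bounds:
  fixes S :: "'a::euclidean_space set"
  assumes P: "prob_space P" and Z: "Z \<in> P \<rightarrow>\<^sub>M restrict_space borel S"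
    and KZ: "admissible_kernel KZ" and KU: "admissible_kernel KU"
    and h: "0 < hZ" "0 < hU" and mass: "0 < kernel_mass (Omega_bar L) KU hU u"
    and c: "\<And>v. kappa (Omega_bar L) KU hU u v \<le> c"
    and lm: "\<And>z'. z' \<in> S \<Longrightarrow> lt z' \<in> borel_measurable (borel_bar L)"
    and cond: "\<And>A. A \<in> sets (borel_bar L) \<Longrightarrow>
          cond_exp_version P (restrict_space borel S) Z
            (\<lambda>\<omega>. emeasure (weighted_measure L w (D \<omega>)) A *
                 indicator {\<omega>. total_mass L w (D \<omega>) \<le> ennreal M} \<omega>)
            (\<lambda>z'. emeasure (density (lebesgue_bar L) (\<lambda>v. ennreal (lt z' v))) A)"
    and near: "\<And>z' v. \<lbrakk>z' \<in> S; v \<in> Omega_bar L; dist z z' \<le> hZ; dist u v \<le> hU\<rbrakk> \<Longrightarrow> \<bar>lt z' v - l\<bar> \<le> \<eta>"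
  defines "m \<equiv> \<integral>\<^sup>+\<omega>. ennreal (kappa S KZ hZ z (Z \<omega>)) \<partial>P"
    and "I \<equiv> \<integral>\<^sup>+\<omega>. ennreal (kappa S KZ hZ z (Z \<omega>) * truncated_smoothed L w KU hU M (D \<omega>) u) \<partial>P"
  shows "ennreal (l - \<eta>) * m \<le> I" and "I \<le> ennreal (l + \<eta>) * m"
proof -
  let ?k = "\<lambda>z'. ennreal (kappa S KZ hZ z z')"
  let ?q = "\<lambda>v. ennreal (kappa (Omega_bar L) KU hU u v)"
  let ?\<nu> = "\<lambda>z'. density (lebesgue_bar L) (\<lambda>v. ennreal (lt z' v))"
  let ?J = "\<lambda>z'. \<integral>\<^sup>+v. ?q v \<partial>?\<nu> z'"
  have sets_bar: "sets (lebesgue_bar L) = sets (borel_bar L)"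
    by (intro sets_restrict_space_cong) simp
  have k: "?k \<in> borel_measurable (restrict_space borel S)"
    using kappa_measurable[OF KZ] by (intro measurable_restrict_space1) simp
  have q: "?q \<in> borel_measurable (borel_bar L)"
    using kappa_measurable_borel_bar[OF KU] by simp
  have ZS: "Z \<omega> \<in> S" if "\<omega> \<in> space P" for \<omega>
    using measurable_space[OF Z that] by (simp add: space_restrict_space)
  have Zb: "Z \<in> borel_measurable P" using Z measurable_restrict_space2_iff by blast
  have kZ: "(\<lambda>\<omega>. ?k (Z \<omega>)) \<in> borel_measurable P"
    using measurable_compose[OF Zb kappa_measurable[OF KZ]] by simp
  have "I = (\<integral>\<^sup>+\<omega>. ?k (Z \<omega>) * (\<integral>\<^sup>+v. ?q v \<partial>truncated_measure L w M (D \<omega>)) \<partial>P)"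
    unfolding I_def
    by (intro nn_integral_cong)
       (simp add: ennreal_mult kappa_nonneg[OF KZ h(1)] truncated_smoothed_nonneg[OF KU h(2)]
          ennreal_truncated_smoothed[OF KU h(2) c])
  also have "\<dots> = (\<integral>\<^sup>+\<omega>. ?k (Z \<omega>) * ?J (Z \<omega>) \<partial>P)"
  proof (rule nn_integral_cond_exp_version_family[OF P Z k, where B = "borel_bar L"])
    show "sets (?\<nu> z') = sets (borel_bar L)" for z' by (simp add: sets_bar)
    show "cond_exp_version P (restrict_space borel S) Z (\<lambda>\<omega>. emeasure (truncated_measure L w M (D \<omega>)) A)
        (\<lambda>z'. emeasure (?\<nu> z') A)" if "A \<in> sets (borel_bar L)" for A
    proof -
      have "(\<lambda>\<omega>. emeasure (truncated_measure L w M (D \<omega>)) A) =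
          (\<lambda>\<omega>. emeasure (weighted_measure L w (D \<omega>)) A *
                 indicator {\<omega>. total_mass L w (D \<omega>) \<le> ennreal M} \<omega>)"
        by (auto simp: emeasure_truncated_measure)
      thus ?thesis using cond[OF that] by simp
    qed
  qed (use q in auto)
  finally have I: "I = (\<integral>\<^sup>+\<omega>. ?k (Z \<omega>) * ?J (Z \<omega>) \<partial>P)" .
  have q': "?q \<in> borel_measurable (lebesgue_bar L)"
    using q measurable_cong_sets[OF sets_bar refl] by blast
  have J: "?J z' = (\<integral>\<^sup>+v. ennreal (lt z' v) * ?q v \<partial>lebesgue_bar L)" if "z' \<in> S" for z'
    using lm[OF that] measurable_cong_sets[OF sets_bar refl] q' by (intro nn_integral_density) auto
  have c1: "(\<integral>\<^sup>+v. ennreal a * ?q v \<partial>lebesgue_bar L) = ennreal a" for a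
    using q' by (simp add: nn_integral_cmult nn_integral_lebesgue_bar_kappa[OF KU h(2) mass])
  have near': "ennreal (l - \<eta>) * ?q v \<le> ennreal (lt z' v) * ?q v \<and> ennreal (lt z' v) * ?q v \<le> ennreal (l + \<eta>) * ?q v"
    if "z' \<in> S" "dist z z' \<le> hZ" "v \<in> Omega_bar L" for z' v
  proof (cases "dist u v \<le> hU")
    case True
    from near[OF that(1,3,2) True] show ?thesis
      by (auto intro!: mult_right_mono ennreal_leI)
  next
    case False
    thus ?thesis using kappa_eq_0_if_dist_gt[OF KU h(2), of u v "Omega_bar L"] by simp
  qed
  have J': "ennreal (l - \<eta>) \<le> ?J z' \<and> ?J z' \<le> ennreal (l + \<eta>)" if z': "z' \<in> S" "dist z z' \<le> hZ" for z'
  proof -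
    have sp: "v \<in> Omega_bar L" if "v \<in> space (lebesgue_bar L)" for v
      using that by (simp add: space_restrict_space)
    have "(\<integral>\<^sup>+v. ennreal (l - \<eta>) * ?q v \<partial>lebesgue_bar L) \<le> ?J z'"
      unfolding J[OF z'(1)] using near'[OF z' sp] by (intro nn_integral_mono) blast
    moreover have "?J z' \<le> (\<integral>\<^sup>+v. ennreal (l + \<eta>) * ?q v \<partial>lebesgue_bar L)"
      unfolding J[OF z'(1)] using near'[OF z' sp] by (intro nn_integral_mono) blast
    ultimately show ?thesis unfolding c1 by blast
  qed
  have kJ: "ennreal (l - \<eta>) * ?k z' \<le> ?k z' * ?J z' \<and> ?k z' * ?J z' \<le> ennreal (l + \<eta>) * ?k z'"
    if "z' \<in> S" for z'
  proof (cases "dist z z' \<le> hZ")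
    case True
    from J'[OF that True] show ?thesis
      by (auto intro!: mult_right_mono simp: mult.commute[of "?k z'"])
  next
    case False
    thus ?thesis using kappa_eq_0_if_dist_gt[OF KZ h(1), of z z' S] by simp
  qed
  have "ennreal (l - \<eta>) * m = (\<integral>\<^sup>+\<omega>. ennreal (l - \<eta>) * ?k (Z \<omega>) \<partial>P)"
    unfolding m_def using kZ by (simp add: nn_integral_cmult)
  also have "\<dots> \<le> I" unfolding I using kJ[OF ZS] by (intro nn_integral_mono) blast
  finally show "ennreal (l - \<eta>) * m \<le> I" .
  have "I \<le> (\<integral>\<^sup>+\<omega>. ennreal (l + \<eta>) * ?k (Z \<omega>) \<partial>P)"
    unfolding I using kJ[OF ZS] by (intro nn_integral_mono) blast
  also have "\<dots> = ennreal (l + \<eta>) * m"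
    unfolding m_def using kZ by (simp add: nn_integral_cmult)
  finally show "I \<le> ennreal (l + \<eta>) * m" .
qed

text \<open>One factor of the squared kernel is bounded by its supremum and the other one is integrated, so
that the bandwidth of \<open>Z\<close> costs only its inverse volume once.\<close>

lemma second_moment_bound:
  fixes S :: "'a::euclidean_space set"
  assumes P: "prob_space P" and Z: "Z \<in> P \<rightarrow>\<^sub>M restrict_space borel S"
    and K: "admissible_kernel K" and h: "0 < h" and b: "\<And>y. kappa S K h z y \<le> b"
    and V: "cond_exp_version P (restrict_space borel S) Z (\<lambda>\<omega>. ennreal ((Y \<omega>)\<^sup>2)) V"
    and Vb: "\<And>z. z \<in> S \<Longrightarrow> V z \<le> ennreal c"
  shows "(\<integral>\<^sup>+\<omega>. ennreal ((kappa S K h z (Z \<omega>) * Y \<omega>)\<^sup>2) \<partial>P) \<le>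
    ennreal b * ennreal c * (\<integral>\<^sup>+\<omega>. ennreal (kappa S K h z (Z \<omega>)) \<partial>P)"
proof -
  let ?k = "kappa S K h z"
  have k0: "0 \<le> ?k y" for y by (rule kappa_nonneg[OF K h])
  have k: "(\<lambda>y. ennreal ((?k y)\<^sup>2)) \<in> borel_measurable (restrict_space borel S)"
    using kappa_measurable[OF K] by (intro measurable_restrict_space1) simp
  have Zb: "Z \<in> borel_measurable P" using Z measurable_restrict_space2_iff by blast
  have kZ: "(\<lambda>\<omega>. ennreal (?k (Z \<omega>))) \<in> borel_measurable P"
    using measurable_compose[OF Zb kappa_measurable[OF K]] by simp
  have "(\<integral>\<^sup>+\<omega>. ennreal ((?k (Z \<omega>) * Y \<omega>)\<^sup>2) \<partial>P) = (\<integral>\<^sup>+\<omega>. ennreal ((?k (Z \<omega>))\<^sup>2) * ennreal ((Y \<omega>)\<^sup>2) \<partial>P)"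
    by (simp add: power_mult_distrib ennreal_mult)
  also have "\<dots> = (\<integral>\<^sup>+\<omega>. ennreal ((?k (Z \<omega>))\<^sup>2) * V (Z \<omega>) \<partial>P)"
    by (rule nn_integral_cond_exp_version[OF P Z V k])
  also have "\<dots> \<le> (\<integral>\<^sup>+\<omega>. (ennreal b * ennreal c) * ennreal (?k (Z \<omega>)) \<partial>P)"
  proof (rule nn_integral_mono)
    fix \<omega> assume "\<omega> \<in> space P"
    hence "Z \<omega> \<in> S" using measurable_space[OF Z] by (simp add: space_restrict_space)
    have "(?k (Z \<omega>))\<^sup>2 \<le> b * ?k (Z \<omega>)"
      using b k0 by (simp add: power2_eq_square mult_right_mono)
    hence "ennreal ((?k (Z \<omega>))\<^sup>2) \<le> ennreal b * ennreal (?k (Z \<omega>))"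
      using k0 by (simp add: ennreal_leI flip: ennreal_mult'')
    hence "ennreal ((?k (Z \<omega>))\<^sup>2) * V (Z \<omega>) \<le> (ennreal b * ennreal (?k (Z \<omega>))) * ennreal c"
      using Vb[OF \<open>Z \<omega> \<in> S\<close>] by (intro mult_mono) auto
    thus "ennreal ((?k (Z \<omega>))\<^sup>2) * V (Z \<omega>) \<le> (ennreal b * ennreal c) * ennreal (?k (Z \<omega>))"
      by (simp only: mult_ac)
  qed
  also have "\<dots> = ennreal b * ennreal c * (\<integral>\<^sup>+\<omega>. ennreal (?k (Z \<omega>)) \<partial>P)"
    using kZ by (rule nn_integral_cmult)
  finally show ?thesis .
qed

section \<open>Rates and the error of the ratio\<close>

text \<open>All the scales are polynomial in \<open>n\<close>: the bandwidth condition makes \<open>n\<close> times the product of the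
bandwidth powers at least one, each factor is at most one, and the rate condition bounds the
truncation level. So the Lipschitz constants of the summands are polynomial in \<open>n\<close>.\<close>

lemma bandwidths_polynomial:
  fixes hZ hU M :: "nat \<Rightarrow> real"
  assumes d: "0 < d"
    and pos: "\<And>n. 1 \<le> n \<Longrightarrow> 0 < hZ n" "\<And>n. 1 \<le> n \<Longrightarrow> 0 < hU n"
    and lim: "hZ \<longlonglongrightarrow> 0" "hU \<longlonglongrightarrow> 0"
    and band: "filterlim (\<lambda>n. real n * hZ n ^ d * hU n ^ 2 / ln (real n)) at_top sequentially"
    and M: "filterlim M at_top sequentially"
    and rate: "(\<lambda>n. M n * ln (real n) / (real n * hZ n ^ d * hU n ^ 2)) \<longlonglongrightarrow> 0"
  shows "\<forall>\<^sub>F n in sequentially. 1 / hZ n \<le> n \<and> 1 / hZ n ^ d \<le> n \<and> 1 / hU n \<le> n \<and> 1 / hU n ^ 2 \<le> n \<and> M n \<le> n"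
proof -
  have e1: "\<forall>\<^sub>F n in sequentially. hZ n < 1" "\<forall>\<^sub>F n in sequentially. hU n < 1"
    using lim by (auto intro: order_tendstoD(2))
  have e2: "\<forall>\<^sub>F n in sequentially. 1 \<le> real n * hZ n ^ d * hU n ^ 2 / ln (real n)"
    using band by (simp add: filterlim_at_top)
  have e3: "\<forall>\<^sub>F n in sequentially. M n * ln (real n) / (real n * hZ n ^ d * hU n ^ 2) < 1"
    using rate by (rule order_tendstoD(2)) simp
  have e4: "\<forall>\<^sub>F n in sequentially. 0 \<le> M n" using M by (simp add: filterlim_at_top)
  show ?thesis
    using e1 e2 e3 e4 eventually_ge_at_top[of 3]
  proof eventually_elim
    case (elim n)
    have z: "0 < hZ n" and u: "0 < hU n" using pos elim by auto
    have "exp (1::real) \<le> 3" using exp_le by simp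
    also have "3 \<le> real n" using elim by simp
    finally have ln: "1 \<le> ln (real n)" using elim by (subst ln_ge_iff) auto
    define x y where "x = hZ n ^ d" and "y = hU n ^ 2"
    have x: "0 < x" "x \<le> hZ n" "x \<le> 1"
    proof -
      show "0 < x" using z by (simp add: x_def)
      have "hZ n ^ d \<le> hZ n ^ 1" using z elim d by (intro power_decreasing) auto
      thus "x \<le> hZ n" by (simp add: x_def)
      thus "x \<le> 1" using elim by linarith
    qed
    have y: "0 < y" "y \<le> hU n" "y \<le> 1"
    proof -
      show "0 < y" using u by (simp add: y_def)
      have "hU n ^ 2 \<le> hU n ^ 1" using u elim by (intro power_decreasing) auto
      thus "y \<le> hU n" by (simp add: y_def)
      thus "y \<le> 1" using elim by linarith
    qed
    have "ln (real n) \<le> real n * x * y" using elim(3) ln by (simp add: x_def y_def field_simps)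
    hence nxy: "1 \<le> real n * x * y" using ln by linarith
    have "real n * x * y \<le> real n * x * 1" using y x by (intro mult_left_mono) auto
    hence nx: "1 \<le> real n * x" using nxy by linarith
    have "real n * x * y \<le> real n * 1 * y" using y x by (intro mult_right_mono mult_left_mono) auto
    hence ny: "1 \<le> real n * y" using nxy by linarith
    have nz: "1 \<le> real n * hZ n" using nx mult_left_mono[OF x(2), of "real n"] by linarith
    have nu: "1 \<le> real n * hU n" using ny mult_left_mono[OF y(2), of "real n"] by linarith
    have "M n \<le> M n * ln (real n)" using mult_left_mono[OF ln elim(5)] by simp
    also have "\<dots> < real n * x * y" using elim(4) nxy by (simp add: x_def y_def field_simps)
    also have "\<dots> \<le> real n" using \<open>real n * x * y \<le> real n * x * 1\<close> mult_left_mono[OF x(3), of "real n"] by simp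
    finally have "M n \<le> n" by simp
    thus ?case using nx ny nz nu x(1) y(1) z u by (simp add: x_def y_def field_simps)
  qed
qed

text \<open>The error of a ratio, controlled through \<open>N - l F\<close>. The deviation of the numerator, the bias, and
the deviation of the denominator enter additively.\<close>

lemma ratio_deviation_le:
  fixes N F mN mF l e \<eta> c C B :: real
  assumes "\<bar>N - mN\<bar> \<le> e" "\<bar>F - mF\<bar> \<le> e" "(l - \<eta>) * mF \<le> mN" "mN \<le> (l + \<eta>) * mF"
    and "0 < c" "c \<le> mF" "mF \<le> C" "e \<le> c / 2" "0 \<le> l" "l \<le> B" "0 \<le> \<eta>"
  shows "\<bar>N / F - l\<bar> \<le> 2 * (e + \<eta> * C + B * e) / c"
proof -
  have F: "c / 2 \<le> F" using assms by linarith
  hence F0: "0 < F" using assms by linarith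
  have "N - l * F = (N - mN) + (mN - l * mF) + l * (mF - F)" by (simp add: algebra_simps)
  also have "\<bar>\<dots>\<bar> \<le> \<bar>N - mN\<bar> + \<bar>mN - l * mF\<bar> + \<bar>l * (mF - F)\<bar>" by linarith
  also have "\<dots> \<le> e + \<eta> * C + B * e"
  proof (intro add_mono)
    have "\<bar>mN - l * mF\<bar> \<le> \<eta> * mF" using assms(3,4) by (simp add: algebra_simps abs_le_iff)
    also have "\<dots> \<le> \<eta> * C" using assms by (intro mult_left_mono)
    finally show "\<bar>mN - l * mF\<bar> \<le> \<eta> * C" .
    have "\<bar>l * (mF - F)\<bar> = l * \<bar>F - mF\<bar>" using assms by (simp add: abs_mult abs_minus_commute)
    also have "\<dots> \<le> B * e" using assms by (intro mult_mono) auto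
    finally show "\<bar>l * (mF - F)\<bar> \<le> B * e" .
  qed (use assms in auto)
  finally have *: "\<bar>N - l * F\<bar> \<le> e + \<eta> * C + B * e" .
  have "N / F - l = (N - l * F) / F" using F0 by (simp add: diff_divide_distrib)
  hence "\<bar>N / F - l\<bar> = \<bar>N - l * F\<bar> / F" using F0 by (simp add: abs_divide)
  also have "\<dots> \<le> (e + \<eta> * C + B * e) / (c / 2)"
    using * F assms by (intro frac_le) auto
  also have "\<dots> = 2 * (e + \<eta> * C + B * e) / c"
    by (simp only: divide_divide_eq_right mult.commute)
  finally show ?thesis .
qed

text \<open>The product rule for increments with the polynomial bounds of the two kernel factors: the fourth
power comes from the Lipschitz bound of \<^const>\<open>kappa\<close>, and the truncation level adds one power.\<close>

lemma product_lipschitz_polynomial: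
  fixes k k' y y' D n :: real
  assumes "0 \<le> k" "k \<le> n ^ 2" "\<bar>k - k'\<bar> \<le> n ^ 4 * D" "0 \<le> y'" "y' \<le> n ^ 3"
    and "\<bar>y - y'\<bar> \<le> n ^ 5 * D" and "2 \<le> n" "0 \<le> D"
  shows "\<bar>k * y - k' * y'\<bar> \<le> n ^ 8 * D"
proof -
  have "k * y - k' * y' = k * (y - y') + (k - k') * y'" by (simp add: algebra_simps)
  also have "\<bar>\<dots>\<bar> \<le> k * \<bar>y - y'\<bar> + \<bar>k - k'\<bar> * y'"
    using assms by (intro order_trans[OF abs_triangle_ineq]) (simp add: abs_mult)
  also have "\<dots> \<le> n ^ 2 * (n ^ 5 * D) + (n ^ 4 * D) * n ^ 3"
    using assms by (intro add_mono mult_mono) auto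
  also have "\<dots> = 2 * (n ^ 7 * D)" by (simp add: algebra_simps flip: power_add)
  also have "\<dots> \<le> n * (n ^ 7 * D)" using assms by (intro mult_right_mono) auto
  also have "\<dots> = n ^ 8 * D" by (simp add: algebra_simps flip: power_Suc)
  finally show ?thesis .
qed

lemma integral_le_of_nn_integral_le:
  assumes "f \<in> borel_measurable M" "\<And>x. 0 \<le> f x" "0 \<le> c" "(\<integral>\<^sup>+x. ennreal (f x) \<partial>M) \<le> ennreal c"
  shows "(LINT x|M. f x) \<le> c"
  using assms integral_eq_nn_integral[of f M] by (simp add: enn2real_leI)

lemma inverse_power_polynomial:
  fixes h n C :: real
  assumes "0 < h" "1 / h ^ d \<le> n" "1 / h \<le> n" "0 \<le> C" "C \<le> n"
  shows "C / h ^ d \<le> n ^ 2" and "C / h ^ (2 * d + 1) \<le> n ^ 4"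
proof -
  have n: "0 \<le> n" using assms by linarith
  have "C * (1 / h ^ d) \<le> n * n" using assms n by (intro mult_mono) auto
  thus "C / h ^ d \<le> n ^ 2" by (simp add: power2_eq_square)
  have "C * (((1 / h ^ d) * (1 / h ^ d)) * (1 / h)) \<le> n * ((n * n) * n)"
    using assms n by (intro mult_mono) auto
  moreover have "h ^ (2 * d + 1) = (h ^ d * h ^ d) * h" by (simp only: mult_2 power_add power_one_right)
  ultimately show "C / h ^ (2 * d + 1) \<le> n ^ 4"
    by (simp only:) (simp add: power4_eq_xxxx mult_ac)
qed

section \<open>Consistency of the intensity estimator\<close>

theorem proposition1:
  fixes L :: real
    and P :: "'w measure"
    and S :: "(real ^ 'd) set"
    and Z :: "'w \<Rightarrow> real ^ 'd" and D :: "'w \<Rightarrow> real \<times> real \<Rightarrow> nat"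
    and Zs :: "nat \<Rightarrow> 'w \<Rightarrow> real ^ 'd" and Ds :: "nat \<Rightarrow> 'w \<Rightarrow> real \<times> real \<Rightarrow> nat"
    and w :: "real \<times> real \<Rightarrow> real"
    and KZ :: "real ^ 'd \<Rightarrow> real" and KU :: "real \<times> real \<Rightarrow> real"
    and hZ hU Mn :: "nat \<Rightarrow> real"
    and p :: "real ^ 'd \<Rightarrow> real" and cZ CZ CY :: real
    and \<Lambda> :: "real ^ 'd \<Rightarrow> (real \<times> real) measure"
    and lam :: "real ^ 'd \<Rightarrow> real \<times> real \<Rightarrow> real"
    and lam_tr :: "nat \<Rightarrow> real ^ 'd \<Rightarrow> real \<times> real \<Rightarrow> real"
    and V :: "nat \<Rightarrow> real ^ 'd \<Rightarrow> real \<times> real \<Rightarrow> ennreal"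
  assumes L_pos: "0 < L"
    and prob: "prob_space P"
    and Z_rv: "Z \<in> P \<rightarrow>\<^sub>M restrict_space borel S"
    and D_rv: "D \<in> P \<rightarrow>\<^sub>M diagram_space L"
    and iid: "iid_copies P (restrict_space borel S \<Otimes>\<^sub>M diagram_space L)
                (\<lambda>i \<omega>. (Zs i \<omega>, Ds i \<omega>)) (\<lambda>\<omega>. (Z \<omega>, D \<omega>))"
    and w_weight: "weight L w"
    and w_bounded: "bounded (w ` Omega_bar L)"
    and w_lipschitz: "\<exists>C. C-lipschitz_on (Omega_bar L) w"
    and KZ: "admissible_kernel KZ"
    and KU: "admissible_kernel KU"
    and hZ_pos: "\<And>n. 1 \<le> n \<Longrightarrow> 0 < hZ n"
    and hU_pos: "\<And>n. 1 \<le> n \<Longrightarrow> 0 < hU n"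
    and hZ_lim: "hZ \<longlonglongrightarrow> 0"
    and hU_lim: "hU \<longlonglongrightarrow> 0"
    and bandwidth: "filterlim (\<lambda>n. real n * hZ n ^ CARD('d) * hU n ^ 2 / ln (real n))
                      at_top sequentially"
    and S_compact: "compact S"
    and S_cone: "cone_condition S"
    and Z_density: "distributed P (restrict_space lborel S) Z (\<lambda>z. ennreal (p z))"
    and p_bounds: "0 < cZ" "\<And>z. z \<in> S \<Longrightarrow> cZ \<le> p z \<and> p z \<le> CZ"
    and \<Lambda>_cond: "\<And>A. A \<in> sets (borel_bar L) \<Longrightarrow>
          cond_exp_version P (restrict_space borel S) Z
            (\<lambda>\<omega>. emeasure (weighted_measure L w (D \<omega>)) A) (\<lambda>z. emeasure (\<Lambda> z) A)"
    and \<Lambda>_density: "\<And>z. z \<in> S \<Longrightarrow> \<Lambda> z = density (lebesgue_bar L) (\<lambda>u. ennreal (lam z u))"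
    and lam_nonneg: "\<And>z u. z \<in> S \<Longrightarrow> u \<in> Omega_bar L \<Longrightarrow> 0 \<le> lam z u"
    and lam_bounded: "bounded ((\<lambda>(z, u). lam z u) ` (S \<times> Omega_bar L))"
    and lam_continuous: "uniformly_continuous_on (S \<times> Omega_bar L) (\<lambda>(z, u). lam z u)"
    and Mn_mono: "mono_on {1..} Mn"
    and Mn_lim: "filterlim Mn at_top sequentially"
    and lam_tr_measurable: "\<And>n z. 1 \<le> n \<Longrightarrow> z \<in> S \<Longrightarrow> lam_tr n z \<in> borel_measurable (borel_bar L)"
    and lam_tr_nonneg: "\<And>n z u. 1 \<le> n \<Longrightarrow> z \<in> S \<Longrightarrow> u \<in> Omega_bar L \<Longrightarrow> 0 \<le> lam_tr n z u"
    and lam_tr_density: "\<And>n A. 1 \<le> n \<Longrightarrow> A \<in> sets (borel_bar L) \<Longrightarrow>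
          cond_exp_version P (restrict_space borel S) Z
            (\<lambda>\<omega>. emeasure (weighted_measure L w (D \<omega>)) A *
                 indicator {\<omega>. total_mass L w (D \<omega>) \<le> ennreal (Mn n)} \<omega>)
            (\<lambda>z. emeasure (density (lebesgue_bar L) (\<lambda>u. ennreal (lam_tr n z u))) A)"
    and tail: "(\<lambda>n. real n * measure P {\<omega> \<in> space P. ennreal (Mn n) < total_mass L w (D \<omega>)})
                 \<longlonglongrightarrow> 0"
    and Mn_rate: "(\<lambda>n. Mn n * ln (real n) / (real n * hZ n ^ CARD('d) * hU n ^ 2)) \<longlonglongrightarrow> 0"
    and lam_tr_lim: "(\<lambda>n. sup_norm L S (\<lambda>z u. lam_tr n z u - lam z u)) \<longlonglongrightarrow> 0"
    and V_cond: "\<And>n u. 1 \<le> n \<Longrightarrow> u \<in> Omega_bar L \<Longrightarrow>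
          cond_exp_version P (restrict_space borel S) Z
            (\<lambda>\<omega>. ennreal ((smoothed L w KU (hU n) (D \<omega>) u)\<^sup>2)) (\<lambda>z. V n z u)"
    and V_bound: "\<And>n. 1 \<le> n \<Longrightarrow>
          (SUP z\<in>S. SUP u\<in>Omega_bar L. V n z u) \<le> ennreal (CY / hU n ^ 2)"
  shows "tendsto_zero_in_prob P (\<lambda>n \<omega>. sup_norm L S (\<lambda>z u.
           lambda_hat L w S KZ KU (hZ n) (hU n) n (\<lambda>i. Zs i \<omega>) (\<lambda>i. Ds i \<omega>) z u - lam z u))"
proof -
  interpret prob_space P by fact
  define N where "N = restrict_space borel S \<Otimes>\<^sub>M diagram_space L"
  define X where "X = (\<lambda>i \<omega>. (Zs i \<omega>, Ds i \<omega>))"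
  define X0 where "X0 = (\<lambda>\<omega>. (Z \<omega>, D \<omega>))"
  define d where "d = CARD('d)"
  have d: "DIM(real ^ 'd) = d" "0 < d" by (simp_all add: d_def)
  have X0: "X0 \<in> P \<rightarrow>\<^sub>M N" unfolding X0_def N_def using Z_rv D_rv by measurable
  have indep: "indep_vars (\<lambda>_. N) X {1..}" and ident: "\<And>i. 1 \<le> i \<Longrightarrow> distr P N (X i) = distr P N X0"
    using iid by (auto simp: iid_copies_def N_def X_def X0_def)
  have X: "X i \<in> P \<rightarrow>\<^sub>M N" if "1 \<le> i" for i
    using indep that unfolding indep_vars_def by auto
  have fst_N: "fst \<in> N \<rightarrow>\<^sub>M restrict_space borel S" and snd_N: "snd \<in> N \<rightarrow>\<^sub>M diagram_space L"
    unfolding N_def by measurable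
  have fst_N': "fst \<in> borel_measurable N" using fst_N measurable_restrict_space2_iff by blast
  have ZS: "Z \<omega> \<in> S" if "\<omega> \<in> space P" for \<omega>
    using measurable_space[OF Z_rv that] by (simp add: space_restrict_space)

  have S_fat: "fat S" by (rule fat_if_cone_condition[OF S_cone])
  obtain C1 h1 where est1: "kappa_estimates S KZ C1 h1"
    by (rule kappa_estimates_exist[OF KZ S_compact S_fat])
  obtain C2 h2 where est2: "kappa_estimates (Omega_bar L) KU C2 h2"
    by (rule kappa_estimates_exist[OF KU compact_Omega_bar fat_Omega_bar[OF L_pos]])
  have dim2: "DIM(real \<times> real) = 2" by simp
  note C1 = kappa_estimatesD(1,2)[OF est1] and C2 = kappa_estimatesD(1,2)[OF est2]
  note mass1 = kappa_estimatesD(3)[OF est1] and mass2 = kappa_estimatesD(3)[OF est2]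
  note bound1 = kappa_estimatesD(4)[OF est1, unfolded d(1)] and lip1 = kappa_estimatesD(5)[OF est1, unfolded d(1)]
  note bound2 = kappa_estimatesD(4)[OF est2, unfolded dim2] and lip2 = kappa_estimatesD(5)[OF est2, unfolded dim2]
  have k1: "0 \<le> kappa S KZ (hZ n) z y" if "1 \<le> n" for n z y
    by (rule kappa_nonneg[OF KZ hZ_pos[OF that]])
  obtain B where B: "0 < B" "\<And>z u. z \<in> S \<Longrightarrow> u \<in> Omega_bar L \<Longrightarrow> lam z u \<le> B"
  proof -
    obtain B where "0 < B" "\<forall>x\<in>(\<lambda>(z, u). lam z u) ` (S \<times> Omega_bar L). norm x \<le> B"
      using lam_bounded bounded_pos by metis
    thus ?thesis by (intro that[of B]) force+
  qed
  obtain z0 where "z0 \<in> S" using ZS not_empty by blast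
  hence CZ: "cZ \<le> CZ" "0 < CZ" using p_bounds by force+

  \<comment> \<open>summands of the truncated numerator and of the denominator, as functions of an observation
      and of the evaluation point\<close>
  define fN where "fN = (\<lambda>n (x :: (real ^ 'd) \<times> (real \<times> real \<Rightarrow> nat)) q.
    kappa S KZ (hZ n) (fst q) (fst x) * truncated_smoothed L w KU (hU n) (Mn n) (snd x) (snd q))"
  define fD where "fD = (\<lambda>n (x :: (real ^ 'd) \<times> (real \<times> real \<Rightarrow> nat)) z. kappa S KZ (hZ n) z (fst x))"
  have fD_meas: "(\<lambda>x. fD n x z) \<in> borel_measurable N" for n z
    unfolding fD_def using measurable_compose[OF fst_N' kappa_measurable[OF KZ]] .
  have fN_meas: "(\<lambda>x. fN n x q) \<in> borel_measurable N" if "1 \<le> n" for n q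
    unfolding fN_def
    by (intro borel_measurable_times measurable_compose[OF fst_N' kappa_measurable[OF KZ]]
        measurable_compose[OF snd_N measurable_truncated_smoothed[OF w_weight KU hU_pos[OF that]]])
  have fD_rv: "(\<lambda>\<omega>. fD n (X0 \<omega>) z) \<in> borel_measurable P" for n z
    using measurable_compose[OF X0 fD_meas] .
  have fN_rv: "(\<lambda>\<omega>. fN n (X0 \<omega>) q) \<in> borel_measurable P" if "1 \<le> n" for n q
    using measurable_compose[OF X0 fN_meas[OF that]] .
  have fD_nonneg: "0 \<le> fD n x z" if "1 \<le> n" for n x z
    unfolding fD_def by (rule k1[OF that])
  have fN_nonneg: "0 \<le> fN n x q" if "1 \<le> n" for n x q
    unfolding fN_def by (intro mult_nonneg_nonneg k1[OF that] truncated_smoothed_nonneg[OF KU hU_pos[OF that]])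

  define good where "good = (\<lambda>n. 2 \<le> n \<and> hZ n \<le> h1 \<and> hU n \<le> h2 \<and> 0 \<le> Mn n \<and> C1 \<le> n \<and> C2 \<le> n \<and>
    1 / hZ n \<le> n \<and> 1 / hZ n ^ d \<le> n \<and> 1 / hU n \<le> n \<and> 1 / hU n ^ 2 \<le> n \<and> Mn n \<le> n)"
  have ev_good: "\<forall>\<^sub>F n in sequentially. good n"
  proof -
    have "\<forall>\<^sub>F n in sequentially. hZ n < h1" "\<forall>\<^sub>F n in sequentially. hU n < h2"
      using order_tendstoD(2)[OF hZ_lim C1(2)] order_tendstoD(2)[OF hU_lim C2(2)] .
    moreover have "\<forall>\<^sub>F n in sequentially. 0 \<le> Mn n" using Mn_lim by (simp add: filterlim_at_top)
    moreover have "\<forall>\<^sub>F n in sequentially. C1 \<le> real n" "\<forall>\<^sub>F n in sequentially. C2 \<le> real n"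
      using filterlim_real_sequentially by (simp_all add: filterlim_at_top)
    moreover have "\<forall>\<^sub>F n in sequentially. 1 / hZ n \<le> n \<and> 1 / hZ n ^ d \<le> n \<and> 1 / hU n \<le> n \<and> 1 / hU n ^ 2 \<le> n \<and> Mn n \<le> n"
      by (rule bandwidths_polynomial[OF d(2) _ _ hZ_lim hU_lim bandwidth[folded d_def] Mn_lim Mn_rate[folded d_def]])
         (use hZ_pos hU_pos in auto)
    moreover note eventually_ge_at_top[of 2]
    ultimately show ?thesis unfolding good_def by eventually_elim auto
  qed
  have good1: "1 \<le> n" if "good n" for n using that by (simp add: good_def)
  have goodZ: "0 < hZ n" "hZ n \<le> h1" "0 < hU n" "hU n \<le> h2" "0 \<le> Mn n" if "good n" for n
    using hZ_pos[OF good1[OF that]] hU_pos[OF good1[OF that]] that by (simp_all add: good_def)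
  have poly: "C1 / hZ n ^ d \<le> real n ^ 2" "C1 / hZ n ^ (2 * d + 1) \<le> real n ^ 4"
      "C2 / hU n ^ 2 \<le> real n ^ 2" "C2 / hU n ^ (2 * 2 + 1) \<le> real n ^ 4" if "good n" for n
    using inverse_power_polynomial[of "hZ n" d "real n" C1] inverse_power_polynomial[of "hU n" 2 "real n" C2]
      that goodZ[OF that] C1(1) C2(1) by (simp_all add: good_def)
  have Y_bound: "truncated_smoothed L w KU (hU n) (Mn n) a u \<le> C2 / hU n ^ 2 * Mn n"
    if "good n" "u \<in> Omega_bar L" for n a u
    by (rule truncated_smoothed_le[OF KU goodZ(3)[OF that(1)] bound2[OF goodZ(3,4)[OF that(1)] that(2)] goodZ(5)[OF that(1)]])
  have fD_bound: "fD n x z \<le> C1 / hZ n ^ d" if "good n" "z \<in> S" for n x z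
    unfolding fD_def by (rule bound1[OF goodZ(1,2)[OF that(1)] that(2)])
  have fN_bound: "fN n x q \<le> C1 / hZ n ^ d * (C2 / hU n ^ 2 * Mn n)" if "good n" "q \<in> S \<times> Omega_bar L" for n x q
    unfolding fN_def
    using that(2) C1(1) goodZ[OF that(1)] truncated_smoothed_nonneg[OF KU goodZ(3)[OF that(1)]]
    by (intro mult_mono bound1[OF goodZ(1,2)[OF that(1)]] Y_bound[OF that(1)]) auto

  have mean_D: "ennreal (expectation (\<lambda>\<omega>. fD n (X0 \<omega>) z)) = (\<integral>\<^sup>+\<omega>. ennreal (kappa S KZ (hZ n) z (Z \<omega>)) \<partial>P)"
    if "good n" "z \<in> S" for n z
  proof -
    have "integrable P (\<lambda>\<omega>. fD n (X0 \<omega>) z)"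
      using fD_rv fD_bound[OF that] fD_nonneg[OF good1[OF that(1)]]
      by (intro integrable_const_bound[where B = "C1 / hZ n ^ d"]) auto
    hence "(\<integral>\<^sup>+\<omega>. ennreal (fD n (X0 \<omega>) z) \<partial>P) = ennreal (expectation (\<lambda>\<omega>. fD n (X0 \<omega>) z))"
      by (rule nn_integral_eq_integral) (intro AE_I2 fD_nonneg good1 that)
    thus ?thesis by (simp add: fD_def X0_def)
  qed
  have mean_N: "ennreal (expectation (\<lambda>\<omega>. fN n (X0 \<omega>) (z, u))) =
      (\<integral>\<^sup>+\<omega>. ennreal (kappa S KZ (hZ n) z (Z \<omega>) * truncated_smoothed L w KU (hU n) (Mn n) (D \<omega>) u) \<partial>P)"
    if "good n" "z \<in> S" "u \<in> Omega_bar L" for n z u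
  proof -
    have "integrable P (\<lambda>\<omega>. fN n (X0 \<omega>) (z, u))"
      using fN_rv[OF good1[OF that(1)]] fN_bound[OF that(1), of "(z, u)"] fN_nonneg[OF good1[OF that(1)]] that(2,3)
      by (intro integrable_const_bound[where B = "C1 / hZ n ^ d * (C2 / hU n ^ 2 * Mn n)"]) auto
    hence "(\<integral>\<^sup>+\<omega>. ennreal (fN n (X0 \<omega>) (z, u)) \<partial>P) = ennreal (expectation (\<lambda>\<omega>. fN n (X0 \<omega>) (z, u)))"
      by (rule nn_integral_eq_integral) (intro AE_I2 fN_nonneg good1 that)
    thus ?thesis by (simp add: fN_def X0_def)
  qed
  have mean_D_bounds: "cZ \<le> expectation (\<lambda>\<omega>. fD n (X0 \<omega>) z)" "expectation (\<lambda>\<omega>. fD n (X0 \<omega>) z) \<le> CZ"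
    if "good n" "z \<in> S" for n z
  proof -
    have mass: "0 < kernel_mass S KZ (hZ n) z" by (rule mass1[OF goodZ(1,2)[OF that(1)] that(2)])
    have nn: "0 \<le> expectation (\<lambda>\<omega>. fD n (X0 \<omega>) z)"
      using fD_nonneg[OF good1[OF that(1)]] by (intro integral_nonneg_AE) auto
    note * = expectation_kappa_bounds[OF KZ S_compact goodZ(1)[OF that(1)] mass Z_density less_imp_le[OF p_bounds(1)] p_bounds(2),
        folded mean_D[OF that]]
    show "cZ \<le> expectation (\<lambda>\<omega>. fD n (X0 \<omega>) z)" using *(1) nn by simp
    show "expectation (\<lambda>\<omega>. fD n (X0 \<omega>) z) \<le> CZ" using *(2) CZ by simp
  qed

  have V_le: "V n z u \<le> ennreal (\<bar>CY\<bar> / hU n ^ 2)" if "1 \<le> n" "z \<in> S" "u \<in> Omega_bar L" for n z u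
  proof -
    have "V n z u \<le> (SUP z\<in>S. SUP u\<in>Omega_bar L. V n z u)"
      using that(2,3) by (auto intro: SUP_upper2)
    also have "\<dots> \<le> ennreal (CY / hU n ^ 2)" by (rule V_bound[OF that(1)])
    also have "\<dots> \<le> ennreal (\<bar>CY\<bar> / hU n ^ 2)"
      by (intro ennreal_leI divide_right_mono) auto
    finally show ?thesis .
  qed
  have second_N: "expectation (\<lambda>\<omega>. (fN n (X0 \<omega>) q)\<^sup>2) \<le> C1 / hZ n ^ d * (\<bar>CY\<bar> / hU n ^ 2) * CZ"
    if g: "good n" and q: "q \<in> S \<times> Omega_bar L" for n q
  proof (rule integral_le_of_nn_integral_le)
    have q': "fst q \<in> S" "snd q \<in> Omega_bar L" using q by auto
    let ?k = "kappa S KZ (hZ n) (fst q)"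
    have b: "0 \<le> C1 / hZ n ^ d" "0 \<le> \<bar>CY\<bar> / hU n ^ 2" using C1(1) goodZ[OF g] by auto
    \<comment> \<open>the moment bound is available without truncation, and truncating only decreases the square\<close>
    have "(\<integral>\<^sup>+\<omega>. ennreal ((fN n (X0 \<omega>) q)\<^sup>2) \<partial>P) \<le>
        (\<integral>\<^sup>+\<omega>. ennreal ((?k (Z \<omega>) * smoothed L w KU (hU n) (D \<omega>) (snd q))\<^sup>2) \<partial>P)"
      by (intro nn_integral_mono ennreal_leI) (simp add: fN_def X0_def truncated_smoothed_eq)
    also have "\<dots> \<le> ennreal (C1 / hZ n ^ d) * ennreal (\<bar>CY\<bar> / hU n ^ 2) * (\<integral>\<^sup>+\<omega>. ennreal (?k (Z \<omega>)) \<partial>P)"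
      by (rule second_moment_bound[OF prob Z_rv KZ goodZ(1)[OF g] bound1[OF goodZ(1,2)[OF g] q'(1)]
            V_cond[OF good1[OF g] q'(2)] V_le[OF good1[OF g] _ q'(2)]])
    also have "\<dots> \<le> ennreal (C1 / hZ n ^ d) * ennreal (\<bar>CY\<bar> / hU n ^ 2) * ennreal CZ"
      unfolding mean_D[OF g q'(1), symmetric] using mean_D_bounds[OF g q'(1)]
      by (intro mult_left_mono ennreal_leI) auto
    also have "\<dots> = ennreal (C1 / hZ n ^ d * (\<bar>CY\<bar> / hU n ^ 2) * CZ)"
      using b CZ by (simp only: ennreal_mult mult_nonneg_nonneg less_imp_le)
    finally show "(\<integral>\<^sup>+\<omega>. ennreal ((fN n (X0 \<omega>) q)\<^sup>2) \<partial>P) \<le> ennreal (C1 / hZ n ^ d * (\<bar>CY\<bar> / hU n ^ 2) * CZ)" .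
    show "0 \<le> C1 / hZ n ^ d * (\<bar>CY\<bar> / hU n ^ 2) * CZ" using b CZ by (intro mult_nonneg_nonneg) auto
    show "(\<lambda>\<omega>. (fN n (X0 \<omega>) q)\<^sup>2) \<in> borel_measurable P"
      using fN_rv[OF good1[OF g]] by (rule borel_measurable_power)
  qed simp
  have second_D: "expectation (\<lambda>\<omega>. (fD n (X0 \<omega>) z)\<^sup>2) \<le> C1 / hZ n ^ d * CZ"
    if g: "good n" and z: "z \<in> S" for n z
  proof -
    have int: "integrable P (\<lambda>\<omega>. fD n (X0 \<omega>) z)"
      using fD_rv fD_bound[OF that] fD_nonneg[OF good1[OF that(1)]]
      by (intro integrable_const_bound[where B = "C1 / hZ n ^ d"]) auto
    have le: "(fD n (X0 \<omega>) z)\<^sup>2 \<le> C1 / hZ n ^ d * fD n (X0 \<omega>) z" for \<omega>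
      unfolding power2_eq_square
      by (intro mult_right_mono fD_bound[OF that] fD_nonneg[OF good1[OF g]])
    have "expectation (\<lambda>\<omega>. (fD n (X0 \<omega>) z)\<^sup>2) \<le> expectation (\<lambda>\<omega>. C1 / hZ n ^ d * fD n (X0 \<omega>) z)"
    proof (rule integral_mono)
      show "integrable P (\<lambda>\<omega>. C1 / hZ n ^ d * fD n (X0 \<omega>) z)" using int by (rule integrable_mult_right)
      thus "integrable P (\<lambda>\<omega>. (fD n (X0 \<omega>) z)\<^sup>2)"
      proof (rule Bochner_Integration.integrable_bound)
        show "(\<lambda>\<omega>. (fD n (X0 \<omega>) z)\<^sup>2) \<in> borel_measurable P"
          using fD_rv by (rule borel_measurable_power)
        show "AE \<omega> in P. norm ((fD n (X0 \<omega>) z)\<^sup>2) \<le> norm (C1 / hZ n ^ d * fD n (X0 \<omega>) z)"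
          using le by (intro AE_I2) (metis abs_of_nonneg order_trans real_norm_def zero_le_power2)
      qed
    qed (rule le)
    also have "\<dots> = C1 / hZ n ^ d * expectation (\<lambda>\<omega>. fD n (X0 \<omega>) z)" by (rule integral_mult_right_zero)
    also have "\<dots> \<le> C1 / hZ n ^ d * CZ"
      using mean_D_bounds[OF that] C1(1) goodZ[OF g] by (intro mult_left_mono) auto
    finally show ?thesis .
  qed

  have lip_D: "\<bar>fD n x z - fD n x z'\<bar> \<le> real n ^ 8 * dist z z'" if g: "good n" and z: "z \<in> S" "z' \<in> S" for n x z z'
  proof -
    have "\<bar>fD n x z - fD n x z'\<bar> \<le> C1 / hZ n ^ (2 * d + 1) * dist z z'"
      unfolding fD_def by (rule lip1[OF goodZ(1,2)[OF g] z])
    also have "\<dots> \<le> real n ^ 4 * dist z z'" by (intro mult_right_mono poly[OF g]) auto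
    also have "\<dots> \<le> real n ^ 8 * dist z z'"
      using good1[OF g] by (intro mult_right_mono power_increasing) auto
    finally show ?thesis .
  qed
  have lip_N: "\<bar>fN n x q - fN n x q'\<bar> \<le> real n ^ 8 * dist q q'"
    if g: "good n" and q: "q \<in> S \<times> Omega_bar L" "q' \<in> S \<times> Omega_bar L" for n x q q'
    unfolding fN_def
  proof (rule product_lipschitz_polynomial)
    have qs: "fst q \<in> S" "fst q' \<in> S" "snd q \<in> Omega_bar L" "snd q' \<in> Omega_bar L" using q by auto
    have n: "2 \<le> real n" "Mn n \<le> real n" using g by (simp_all add: good_def)
    show "0 \<le> kappa S KZ (hZ n) (fst q) (fst x)" by (rule k1[OF good1[OF g]])
    show "kappa S KZ (hZ n) (fst q) (fst x) \<le> real n ^ 2"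
      by (rule order_trans[OF bound1[OF goodZ(1,2)[OF g] qs(1)] poly(1)[OF g]])
    have "\<bar>kappa S KZ (hZ n) (fst q) (fst x) - kappa S KZ (hZ n) (fst q') (fst x)\<bar>
        \<le> C1 / hZ n ^ (2 * d + 1) * dist (fst q) (fst q')"
      by (rule lip1[OF goodZ(1,2)[OF g] qs(1,2)])
    also have "\<dots> \<le> real n ^ 4 * dist q q'"
      by (intro mult_mono poly[OF g] dist_fst_le) auto
    finally show "\<bar>kappa S KZ (hZ n) (fst q) (fst x) - kappa S KZ (hZ n) (fst q') (fst x)\<bar> \<le> real n ^ 4 * dist q q'" .
    show "0 \<le> truncated_smoothed L w KU (hU n) (Mn n) (snd x) (snd q')"
      by (rule truncated_smoothed_nonneg[OF KU goodZ(3)[OF g]])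
    have "truncated_smoothed L w KU (hU n) (Mn n) (snd x) (snd q') \<le> C2 / hU n ^ 2 * Mn n"
      by (rule Y_bound[OF g qs(4)])
    also have "\<dots> \<le> real n ^ 2 * real n" using n goodZ(5)[OF g] by (intro mult_mono poly[OF g]) auto
    finally show "truncated_smoothed L w KU (hU n) (Mn n) (snd x) (snd q') \<le> real n ^ 3"
      by (simp add: power2_eq_square power3_eq_cube)
    have "\<bar>truncated_smoothed L w KU (hU n) (Mn n) (snd x) (snd q) - truncated_smoothed L w KU (hU n) (Mn n) (snd x) (snd q')\<bar>
        \<le> (C2 / hU n ^ (2 * 2 + 1) * dist (snd q) (snd q')) * Mn n"
      by (rule truncated_smoothed_lipschitz[OF KU goodZ(3)[OF g] bound2[OF goodZ(3,4)[OF g] qs(3)]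
            bound2[OF goodZ(3,4)[OF g] qs(4)] lip2[OF goodZ(3,4)[OF g] qs(3,4)] goodZ(5)[OF g]])
    also have "\<dots> \<le> (real n ^ 4 * dist q q') * real n"
      using n goodZ(5)[OF g] by (intro mult_mono poly[OF g] dist_snd_le) auto
    also have "\<dots> = real n ^ 5 * dist q q'" by (simp add: eval_nat_numeral)
    finally show "\<bar>truncated_smoothed L w KU (hU n) (Mn n) (snd x) (snd q) -
        truncated_smoothed L w KU (hU n) (Mn n) (snd x) (snd q')\<bar> \<le> real n ^ 5 * dist q q'" .
    show "2 \<le> real n" by (rule n)
  qed simp

  \<comment> \<open>range bound and second moment, both times \<open>ln n / n\<close>, for the numerator and for the
      denominator\<close>
  define R where "R = (\<lambda>n. ln (real n) / (real n * hZ n ^ d * hU n ^ 2))"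
  have R: "R \<longlonglongrightarrow> 0"
    using filterlim_compose[OF tendsto_inverse_0_at_top[OF bandwidth] filterlim_ident]
    unfolding R_def d_def by (simp add: inverse_eq_divide)
  have rate_bN: "(\<lambda>n. C1 / hZ n ^ d * (C2 / hU n ^ 2 * Mn n) * ln (real n) / real n) \<longlonglongrightarrow> 0"
  proof -
    have "(\<lambda>n. C1 * C2 * (Mn n * ln (real n) / (real n * hZ n ^ d * hU n ^ 2))) \<longlonglongrightarrow> 0"
      by (rule tendsto_mult_right_zero[OF Mn_rate[folded d_def]])
    thus ?thesis by (simp add: field_simps)
  qed
  have rate_vN: "(\<lambda>n. C1 / hZ n ^ d * (\<bar>CY\<bar> / hU n ^ 2) * CZ * ln (real n) / real n) \<longlonglongrightarrow> 0"
    using tendsto_mult_right_zero[OF R, of "C1 * \<bar>CY\<bar> * CZ"] by (simp add: R_def field_simps)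
  have R': "(\<lambda>n. ln (real n) / (real n * hZ n ^ d)) \<longlonglongrightarrow> 0"
  proof (rule Lim_transform_eventually)
    show "(\<lambda>n. R n * hU n ^ 2) \<longlonglongrightarrow> 0"
      using tendsto_mult[OF R tendsto_power[OF hU_lim, of 2]] by simp
    show "\<forall>\<^sub>F n in sequentially. R n * hU n ^ 2 = ln (real n) / (real n * hZ n ^ d)"
      using ev_good
    proof eventually_elim
      case (elim n)
      thus ?case using goodZ(3)[OF elim] by (simp add: R_def)
    qed
  qed
  have rate_bD: "(\<lambda>n. C1 / hZ n ^ d * ln (real n) / real n) \<longlonglongrightarrow> 0"
    using tendsto_mult_right_zero[OF R', of C1] by (simp add: field_simps)
  have rate_vD: "(\<lambda>n. C1 / hZ n ^ d * CZ * ln (real n) / real n) \<longlonglongrightarrow> 0"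
    using tendsto_mult_right_zero[OF R', of "C1 * CZ"] by (simp add: field_simps)

  have near: "\<forall>\<^sub>F n in sequentially. \<forall>z\<in>S. \<forall>u\<in>Omega_bar L. \<forall>z'\<in>S. \<forall>v\<in>Omega_bar L.
      dist z z' \<le> hZ n \<longrightarrow> dist u v \<le> hU n \<longrightarrow> \<bar>lam_tr n z' v - lam z u\<bar> \<le> \<eta>" if \<eta>: "0 < \<eta>" for \<eta>
  proof -
    obtain \<delta> where \<delta>: "0 < \<delta>" and uc: "\<And>x x'. \<lbrakk>x \<in> S \<times> Omega_bar L; x' \<in> S \<times> Omega_bar L; dist x' x < \<delta>\<rbrakk> \<Longrightarrow>
        dist (case x' of (z, u) \<Rightarrow> lam z u) (case x of (z, u) \<Rightarrow> lam z u) < \<eta> / 2"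
      using lam_continuous \<eta> unfolding uniformly_continuous_on_def by (meson half_gt_zero)
    have "\<forall>\<^sub>F n in sequentially. sup_norm L S (\<lambda>z u. lam_tr n z u - lam z u) < ennreal (\<eta> / 2)"
      using lam_tr_lim \<eta> by (intro order_tendstoD(2)[of _ 0]) auto
    moreover have "\<forall>\<^sub>F n in sequentially. hZ n < \<delta> / 2" "\<forall>\<^sub>F n in sequentially. hU n < \<delta> / 2"
      using order_tendstoD(2)[OF hZ_lim half_gt_zero[OF \<delta>]] order_tendstoD(2)[OF hU_lim half_gt_zero[OF \<delta>]] .
    ultimately show ?thesis
    proof eventually_elim
      case (elim n)
      show ?case
      proof (intro ballI impI)
        fix z u z' v assume in_dom: "z \<in> S" "u \<in> Omega_bar L" "z' \<in> S" "v \<in> Omega_bar L"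
          and close: "dist z z' \<le> hZ n" "dist u v \<le> hU n"
        have "ennreal \<bar>lam_tr n z' v - lam z' v\<bar> \<le> sup_norm L S (\<lambda>z u. lam_tr n z u - lam z u)"
          unfolding sup_norm_def using in_dom by (auto intro!: SUP_upper2[of z'] SUP_upper2[of v])
        also note elim(1)
        finally have 1: "\<bar>lam_tr n z' v - lam z' v\<bar> < \<eta> / 2" by (simp add: ennreal_less_iff)
        have "dist (z', v) (z, u) \<le> dist z z' + dist u v"
          unfolding dist_Pair_Pair by (simp add: dist_commute sqrt_sum_squares_le_sum)
        hence "dist (z', v) (z, u) < \<delta>" using close elim by linarith
        hence 2: "\<bar>lam z' v - lam z u\<bar> < \<eta> / 2"
          using uc[of "(z, u)" "(z', v)"] in_dom by (simp add: dist_real_def)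
        show "\<bar>lam_tr n z' v - lam z u\<bar> \<le> \<eta>" using 1 2 by linarith
      qed
    qed
  qed

  define T where "T = (\<lambda>n. \<Union>i\<in>{1..n}. {\<omega>\<in>space P. ennreal (Mn n) < total_mass L w (Ds i \<omega>)})"
  have mass_N: "{x \<in> space N. ennreal (Mn n) < total_mass L w (snd x)} \<in> sets N" for n
    using measurable_compose[OF snd_N measurable_total_mass[OF w_weight]] by measurable
  have T_i: "{\<omega>\<in>space P. ennreal (Mn n) < total_mass L w (Ds i \<omega>)} \<in> events"
      "prob {\<omega>\<in>space P. ennreal (Mn n) < total_mass L w (Ds i \<omega>)} =
       prob {\<omega>\<in>space P. ennreal (Mn n) < total_mass L w (D \<omega>)}" if i: "1 \<le> i" for n i
  proof -
    let ?A = "{x \<in> space N. ennreal (Mn n) < total_mass L w (snd x)}"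
    have 1: "{\<omega>\<in>space P. ennreal (Mn n) < total_mass L w (Ds i \<omega>)} = X i -` ?A \<inter> space P"
      using measurable_space[OF X[OF i]] by (auto simp: X_def)
    have 2: "{\<omega>\<in>space P. ennreal (Mn n) < total_mass L w (D \<omega>)} = X0 -` ?A \<inter> space P"
      using measurable_space[OF X0] by (auto simp: X0_def)
    show "{\<omega>\<in>space P. ennreal (Mn n) < total_mass L w (Ds i \<omega>)} \<in> events"
      unfolding 1 by (rule measurable_sets[OF X[OF i] mass_N])
    show "prob {\<omega>\<in>space P. ennreal (Mn n) < total_mass L w (Ds i \<omega>)} =
       prob {\<omega>\<in>space P. ennreal (Mn n) < total_mass L w (D \<omega>)}"
      unfolding 1 2 measure_distr[OF X[OF i] mass_N, symmetric] measure_distr[OF X0 mass_N, symmetric] ident[OF i] ..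
  qed
  have T: "T n \<in> events" for n unfolding T_def using T_i(1) by (intro sets.finite_UN) auto
  have prob_T: "prob (T n) \<le> real n * prob {\<omega>\<in>space P. ennreal (Mn n) < total_mass L w (D \<omega>)}" for n
  proof -
    have "prob (T n) \<le> (\<Sum>i\<in>{1..n}. prob {\<omega>\<in>space P. ennreal (Mn n) < total_mass L w (Ds i \<omega>)})"
      unfolding T_def using T_i(1) by (intro finite_measure_subadditive_finite) auto
    also have "\<dots> = (\<Sum>i\<in>{1..n}. prob {\<omega>\<in>space P. ennreal (Mn n) < total_mass L w (D \<omega>)})"
      by (intro sum.cong T_i(2)) auto
    finally show ?thesis by simp
  qed
  have lim_T: "(\<lambda>n. prob (T n)) \<longlonglongrightarrow> 0"
    by (rule tendsto_sandwich[OF always_eventually[OF allI[OF measure_nonneg]]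
          always_eventually[OF allI[OF prob_T]] tendsto_const tail])

  show ?thesis
    unfolding tendsto_zero_in_prob_def
  proof (intro allI impI)
    fix \<epsilon> :: real assume \<epsilon>: "0 < \<epsilon>"
    \<comment> \<open>\<open>e\<close> is the stochastic error, which must also keep the denominator above \<open>cZ / 2\<close>, and \<open>\<eta>\<close> is
        the bias\<close>
    define e where "e = min (cZ / 2) (\<epsilon> * cZ / (8 * (1 + B)))"
    define \<eta> where "\<eta> = \<epsilon> * cZ / (8 * CZ)"
    have e: "0 < e" "e \<le> cZ / 2" and \<eta>: "0 < \<eta>"
    proof -
      show "0 < e" "0 < \<eta>" using \<epsilon> p_bounds(1) B(1) CZ by (auto simp: e_def \<eta>_def)
      show "e \<le> cZ / 2" unfolding e_def by (rule min.cobounded1)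
    qed
    have total: "2 * (e + \<eta> * CZ + B * e) / cZ \<le> \<epsilon>"
    proof -
      have "(1 + B) * e \<le> (1 + B) * (\<epsilon> * cZ / (8 * (1 + B)))"
        unfolding e_def using B(1) by (intro mult_left_mono) auto
      also have "\<dots> = \<epsilon> * cZ / 8" using B(1) by (simp add: field_simps)
      finally have 1: "e + B * e \<le> \<epsilon> * cZ / 8" by (simp add: distrib_right)
      have 2: "\<eta> * CZ = \<epsilon> * cZ / 8" using CZ by (simp add: \<eta>_def)
      have 3: "0 < \<epsilon> * cZ" using \<epsilon> p_bounds(1) by simp
      have "2 * (a + b + a') \<le> t" if "a + a' \<le> t / 8" "b = t / 8" "0 < t" for a b a' t :: real
        using that by (simp add: distrib_left)
      from this[OF 1 2 3] have "2 * (e + \<eta> * CZ + B * e) \<le> \<epsilon> * cZ" .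
      thus ?thesis using p_bounds(1) by (simp only: pos_divide_le_eq)
    qed
    have bQ: "bounded (S \<times> Omega_bar L)" "bounded S"
      using compact_imp_bounded[OF S_compact] compact_imp_bounded[OF compact_Omega_bar[of L]]
      by (simp_all add: bounded_Times)
    obtain B1 where B1: "\<And>n. B1 n \<in> events" "(\<lambda>n. prob (B1 n)) \<longlonglongrightarrow> 0"
      "\<forall>\<^sub>F n in sequentially. \<forall>\<omega>\<in>space P - B1 n. \<forall>q\<in>S \<times> Omega_bar L.
         \<bar>(\<Sum>i=1..n. fN n (X i \<omega>) q) / n - expectation (\<lambda>\<omega>. fN n (X0 \<omega>) q)\<bar> \<le> e"
    proof (rule uniform_concentration[OF indep X0 ident bQ(1) e(1), where f = fN and k = 8])
      show "\<forall>\<^sub>F n in sequentially. \<forall>x\<in>space N. \<forall>q\<in>S \<times> Omega_bar L.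
          0 \<le> fN n x q \<and> fN n x q \<le> C1 / hZ n ^ d * (C2 / hU n ^ 2 * Mn n)"
        using ev_good by eventually_elim (intro ballI conjI fN_nonneg fN_bound good1)
      show "\<forall>\<^sub>F n in sequentially. \<forall>q\<in>S \<times> Omega_bar L.
          expectation (\<lambda>\<omega>. (fN n (X0 \<omega>) q)\<^sup>2) \<le> C1 / hZ n ^ d * (\<bar>CY\<bar> / hU n ^ 2) * CZ"
        using ev_good by eventually_elim (intro ballI second_N)
      show "\<forall>\<^sub>F n in sequentially. \<forall>x\<in>space N. \<forall>q\<in>S \<times> Omega_bar L. \<forall>q'\<in>S \<times> Omega_bar L.
          \<bar>fN n x q - fN n x q'\<bar> \<le> real n ^ 8 * dist q q'"
        using ev_good by eventually_elim (intro ballI lip_N)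
    qed (use fN_meas rate_bN rate_vN in auto)
    obtain B2 where B2: "\<And>n. B2 n \<in> events" "(\<lambda>n. prob (B2 n)) \<longlonglongrightarrow> 0"
      "\<forall>\<^sub>F n in sequentially. \<forall>\<omega>\<in>space P - B2 n. \<forall>z\<in>S.
         \<bar>(\<Sum>i=1..n. fD n (X i \<omega>) z) / n - expectation (\<lambda>\<omega>. fD n (X0 \<omega>) z)\<bar> \<le> e"
    proof (rule uniform_concentration[OF indep X0 ident bQ(2) e(1), where f = fD and k = 8])
      show "\<forall>\<^sub>F n in sequentially. \<forall>x\<in>space N. \<forall>z\<in>S. 0 \<le> fD n x z \<and> fD n x z \<le> C1 / hZ n ^ d"
        using ev_good by eventually_elim (intro ballI conjI fD_nonneg fD_bound good1)
      show "\<forall>\<^sub>F n in sequentially. \<forall>z\<in>S. expectation (\<lambda>\<omega>. (fD n (X0 \<omega>) z)\<^sup>2) \<le> C1 / hZ n ^ d * CZ"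
        using ev_good by eventually_elim (intro ballI second_D)
      show "\<forall>\<^sub>F n in sequentially. \<forall>x\<in>space N. \<forall>z\<in>S. \<forall>z'\<in>S. \<bar>fD n x z - fD n x z'\<bar> \<le> real n ^ 8 * dist z z'"
        using ev_good by eventually_elim (intro ballI lip_D)
    qed (use fD_meas rate_bD rate_vD in auto)

    define Xn where "Xn = (\<lambda>n \<omega>. sup_norm L S (\<lambda>z u.
      lambda_hat L w S KZ KU (hZ n) (hU n) n (\<lambda>i. Zs i \<omega>) (\<lambda>i. Ds i \<omega>) z u - lam z u))"
    have incl: "\<forall>\<^sub>F n in sequentially. {\<omega> \<in> space P. ennreal \<epsilon> < Xn n \<omega>} \<subseteq> B1 n \<union> B2 n \<union> T n"
      using ev_good near[OF \<eta>] B1(3) B2(3)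
    proof eventually_elim
      case (elim n)
      note g = elim(1)
      have "Xn n \<omega> \<le> ennreal \<epsilon>" if \<omega>: "\<omega> \<in> space P" "\<omega> \<notin> B1 n" "\<omega> \<notin> B2 n" "\<omega> \<notin> T n" for \<omega>
        unfolding Xn_def sup_norm_def
      proof (intro SUP_least ennreal_leI)
        fix z u assume z: "z \<in> S" and u: "u \<in> Omega_bar L"
        define NN FF where "NN = (\<Sum>i=1..n. fN n (X i \<omega>) (z, u)) / n" and "FF = (\<Sum>i=1..n. fD n (X i \<omega>) z) / n"
        define mN mF where "mN = expectation (\<lambda>\<omega>. fN n (X0 \<omega>) (z, u))" and "mF = expectation (\<lambda>\<omega>. fD n (X0 \<omega>) z)"
        have n: "0 < real n" using good1[OF g] by simp
        have "smoothed L w KU (hU n) (Ds i \<omega>) u = truncated_smoothed L w KU (hU n) (Mn n) (Ds i \<omega>) u"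
          if "i \<in> {1..n}" for i
          using \<omega>(1,4) that by (auto simp: T_def truncated_smoothed_eq not_less)
        hence "lambda_hat L w S KZ KU (hZ n) (hU n) n (\<lambda>i. Zs i \<omega>) (\<lambda>i. Ds i \<omega>) z u
            = (\<Sum>i=1..n. fN n (X i \<omega>) (z, u)) / (\<Sum>i=1..n. fD n (X i \<omega>) z)"
          unfolding lambda_hat_def fN_def fD_def X_def by simp
        also have "\<dots> = NN / FF" using n by (simp add: NN_def FF_def)
        finally have hat: "lambda_hat L w S KZ KU (hZ n) (hU n) n (\<lambda>i. Zs i \<omega>) (\<lambda>i. Ds i \<omega>) z u = NN / FF" .
        have devN: "\<bar>NN - mN\<bar> \<le> e" using elim(3) \<omega> z u by (auto simp: NN_def mN_def)
        have devD: "\<bar>FF - mF\<bar> \<le> e" using elim(4) \<omega> z by (auto simp: FF_def mF_def)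
        have mF: "cZ \<le> mF" "mF \<le> CZ" unfolding mF_def by (rule mean_D_bounds[OF g z])+
        have mN0: "0 \<le> mN" unfolding mN_def using fN_nonneg[OF good1[OF g]] by (intro integral_nonneg_AE) auto
        have l: "0 \<le> lam z u" "lam z u \<le> B" by (rule lam_nonneg[OF z u], rule B(2)[OF z u])
        have mass: "0 < kernel_mass (Omega_bar L) KU (hU n) u" by (rule mass2[OF goodZ(3,4)[OF g] u])
        note bounds = numerator_mean_bounds[OF prob Z_rv KZ KU goodZ(1,3)[OF g] mass bound2[OF goodZ(3,4)[OF g] u]
            lam_tr_measurable[OF good1[OF g]] lam_tr_density[OF good1[OF g]], where z = z and l = "lam z u" and \<eta> = \<eta>,
            folded mean_D[OF g z] mean_N[OF g z u], folded mN_def mF_def]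
        have nr: "\<bar>lam_tr n z' v - lam z u\<bar> \<le> \<eta>"
          if "z' \<in> S" "v \<in> Omega_bar L" "dist z z' \<le> hZ n" "dist u v \<le> hU n" for z' v
          using elim(2) z u that by blast
        have mF0: "0 \<le> mF" using mF p_bounds(1) by linarith
        have lo: "(lam z u - \<eta>) * mF \<le> mN"
        proof (cases "0 \<le> lam z u - \<eta>")
          case True
          have "ennreal ((lam z u - \<eta>) * mF) \<le> ennreal mN"
            using bounds(1)[OF _ _ nr] True mF0 by (simp add: ennreal_mult)
          thus ?thesis using mN0 by simp
        next
          case False
          hence "(lam z u - \<eta>) * mF \<le> 0" using mF0 by (intro mult_nonpos_nonneg) auto
          thus ?thesis using mN0 by linarith
        qed
        have "ennreal mN \<le> ennreal ((lam z u + \<eta>) * mF)"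
          using bounds(2)[OF _ _ nr] l \<eta> mF0 by (simp add: ennreal_mult)
        hence hi: "mN \<le> (lam z u + \<eta>) * mF" using l \<eta> mF0 by (simp add: ennreal_le_iff)
        show "\<bar>lambda_hat L w S KZ KU (hZ n) (hU n) n (\<lambda>i. Zs i \<omega>) (\<lambda>i. Ds i \<omega>) z u - lam z u\<bar> \<le> \<epsilon>"
          unfolding hat
          by (rule order_trans[OF ratio_deviation_le[OF devN devD lo hi p_bounds(1) mF e(2) l less_imp_le[OF \<eta>]] total])
      qed
      thus ?case by (force simp: not_le[symmetric])
    qed
    have "\<forall>\<^sub>F n in sequentially. outer_measure_of P {\<omega> \<in> space P. ennreal \<epsilon> < Xn n \<omega>}
        \<le> ennreal (prob (B1 n) + prob (B2 n) + prob (T n))"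
      using incl
    proof eventually_elim
      case (elim n)
      have "outer_measure_of P {\<omega> \<in> space P. ennreal \<epsilon> < Xn n \<omega>} \<le> outer_measure_of P (B1 n \<union> B2 n \<union> T n)"
        using elim by (rule outer_measure_of_mono)
      also have "\<dots> = emeasure P (B1 n \<union> B2 n \<union> T n)"
        using B1(1) B2(1) T by (intro outer_measure_of_eq) auto
      also have "\<dots> = ennreal (prob (B1 n \<union> B2 n \<union> T n))" by (rule emeasure_eq_measure)
      also have "\<dots> \<le> ennreal (prob (B1 n) + prob (B2 n) + prob (T n))"
      proof (rule ennreal_leI)
        have "prob (B1 n \<union> B2 n \<union> T n) \<le> prob (B1 n \<union> B2 n) + prob (T n)"
          using B1(1) B2(1) T by (intro measure_Un_le) auto
        also have "prob (B1 n \<union> B2 n) \<le> prob (B1 n) + prob (B2 n)"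
          using B1(1) B2(1) by (intro measure_Un_le) auto
        finally show "prob (B1 n \<union> B2 n \<union> T n) \<le> prob (B1 n) + prob (B2 n) + prob (T n)" by simp
      qed
      finally show ?case .
    qed
    moreover have "(\<lambda>n. ennreal (prob (B1 n) + prob (B2 n) + prob (T n))) \<longlonglongrightarrow> ennreal (0 + 0 + 0)"
      by (intro tendsto_ennrealI tendsto_add B1(2) B2(2) lim_T)
    hence "(\<lambda>n. ennreal (prob (B1 n) + prob (B2 n) + prob (T n))) \<longlonglongrightarrow> 0" by simp
    ultimately have "(\<lambda>n. outer_measure_of P {\<omega> \<in> space P. ennreal \<epsilon> < Xn n \<omega>}) \<longlonglongrightarrow> 0"
      by (rule tendsto_sandwich[OF always_eventually[OF allI[OF zero_le]] _ tendsto_const])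
    thus "(\<lambda>n. outer_measure_of P {\<omega> \<in> space P. ennreal \<epsilon> < sup_norm L S (\<lambda>z u.
        lambda_hat L w S KZ KU (hZ n) (hU n) n (\<lambda>i. Zs i \<omega>) (\<lambda>i. Ds i \<omega>) z u - lam z u)}) \<longlonglongrightarrow> 0"
      unfolding Xn_def .
  qed
qed

end
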